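(* Let $\mathfrak{A}$ be a unital $C^*$-algebra and let $I$ be a closed two-sided ideal of the infinite free product $\ast_{\mathbb{N}}\mathfrak{A}$ such that: (i) $I$ is invariant under the natural action of $\mathbb{P}_{\mathbb{N}}$ on $\ast_{\mathbb{N}}\mathfrak{A}$; (ii) the closure of the linear span of all ordered monomials is the whole quotient $\ast_{\mathbb{N}}\mathfrak{A}/I$. Then a quantum stochastic process with sample algebra $\mathfrak{A}$ whose distribution factorizes through $\ast_{\mathbb{N}}\mathfrak{A}/I$ is spreadable if and only if it is exchangeable.
   Context: $\mathbb{N}$ includes $0$. $\ast_{\mathbb{N}}\mathfrak{A}$ is the (unital, universal) free product $C^*$-algebra of countably many copies of $\mathfrak{A}$, with canonical embeddings $i_j:\mathfrak{A}\to\ast_{\mathbb{N}}\mathfrak{A}$, $j\in\mathbb{N}$. A quantum stochastic process with sample algebra $\mathfrak{A}$ is a quadruple $(\mathfrak{A},\mathcal{H},\{\iota_j\}_{j\in\mathbb{N}},\xi)$, where $\mathcal{H}$ is a Hilbert space, each $\iota_j$ is a unital $*$-representation of $\mathfrak{A}$ on $\mathcal{H}$, and $\xi\in\mathcal{H}$ is a unit vector cyclic for the von Neumann algebra $\bigvee_j\iota_j(\mathfrak{A})$. Its distribution is the state $\varphi$ on $\ast_{\mathbb{N}}\mathfrak{A}$ with $\varphi(i_{j_1}(a_1)\cdots i_{j_n}(a_n))=\langle\iota_{j_1}(a_1)\cdots\iota_{j_n}(a_n)\xi,\xi\rangle$ for all $n$, $j_1\neq j_2\neq\cdots\neq j_n$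 in $\mathbb{N}$ and $a_1,\dots,a_n\in\mathfrak{A}$. $\mathbb{P}_{\mathbb{N}}$ is the group of bijections of $\mathbb{N}$ moving only finitely many elements; it acts on $\ast_{\mathbb{N}}\mathfrak{A}$ by automorphisms $\alpha_\sigma(i_j(a))=i_{\sigma(j)}(a)$. The process is exchangeable if $\varphi\circ\alpha_\sigma=\varphi$ for all $\sigma\in\mathbb{P}_{\mathbb{N}}$. It is spreadable if $\varphi\circ\alpha_f=\varphi$ for every strictly increasing $f:\mathbb{N}\to\mathbb{N}$, where $\alpha_f$ is the endomorphism with $\alpha_f(i_j(a))=i_{f(j)}(a)$. Let $p_I:\ast_{\mathbb{N}}\mathfrak{A}\to\ast_{\mathbb{N}}\mathfrak{A}/I$ be the canonical projection. The distribution $\varphi$ factorizes through $\ast_{\mathbb{N}}\mathfrak{A}/I$ if $\varphi=\widetilde{\varphi}\circ p_I$ for some state $\widetilde\varphi$ on $\ast_{\mathbb{N}}\mathfrak{A}/I$. An ordered monomial is an element $p_I(i_{j_1}(a_1)\cdots i_{j_n}(a_n))$ with $n\in\mathbb{N}$, $a_1,\dots,a_n\in\mathfrak{A}$, and either $j_1<\cdots<j_n$ or $j_1>\cdots>j_n$. *)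

theory Defs
  imports "HOL-Analysis.Analysis" "HOL-Algebra.Module" "HOL-Algebra.QuotRing"
    "HOL-Library.Poly_Mapping"
begin

section \<open>Unital C*-algebras\<close>

text \<open>
  Complex scalar multiplication is the field \<open>smult\<close> of the library's \<open>module\<close> record.
\<close>

record 'a star_alg = "(complex, 'a) module" +
  star :: "'a \<Rightarrow> 'a"
  nrm :: "'a \<Rightarrow> real"

definition nrm_dist :: "('a, 'm) star_alg_scheme \<Rightarrow> 'a \<Rightarrow> 'a \<Rightarrow> real" where
  "nrm_dist A x y =
     (if x \<in> carrier A \<and> y \<in> carrier A then nrm A (x \<ominus>\<^bsub>A\<^esub> y) else 0)"

definition nrm_topology :: "('a, 'm) star_alg_scheme \<Rightarrow> 'a topology" where
  "nrm_topology A = Metric_space.mtopology (carrier A) (nrm_dist A)"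

text \<open>The zero algebra is not excluded.\<close>

locale unital_cstar_algebra = ring A for A :: "('a, 'm) star_alg_scheme" (structure) +
  assumes smult_closed: "x \<in> carrier A \<Longrightarrow> c \<odot> x \<in> carrier A"
    and smult_add_left: "x \<in> carrier A \<Longrightarrow> (c + d) \<odot> x = c \<odot> x \<oplus> d \<odot> x"
    and smult_add_right:
      "x \<in> carrier A \<Longrightarrow> y \<in> carrier A \<Longrightarrow> c \<odot> (x \<oplus> y) = c \<odot> x \<oplus> c \<odot> y"
    and smult_smult: "x \<in> carrier A \<Longrightarrow> c \<odot> (d \<odot> x) = (c * d) \<odot> x"
    and smult_one: "x \<in> carrier A \<Longrightarrow> 1 \<odot> x = x"
    and smult_mult_left:
      "x \<in> carrier A \<Longrightarrow> y \<in> carrier A \<Longrightarrow> (c \<odot> x) \<otimes> y = c \<odot> (x \<otimes> y)"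
    and smult_mult_right:
      "x \<in> carrier A \<Longrightarrow> y \<in> carrier A \<Longrightarrow> x \<otimes> (c \<odot> y) = c \<odot> (x \<otimes> y)"
    and star_closed: "x \<in> carrier A \<Longrightarrow> star A x \<in> carrier A"
    and star_star: "x \<in> carrier A \<Longrightarrow> star A (star A x) = x"
    and star_add: "x \<in> carrier A \<Longrightarrow> y \<in> carrier A \<Longrightarrow> star A (x \<oplus> y) = star A x \<oplus> star A y"
    and star_smult: "x \<in> carrier A \<Longrightarrow> star A (c \<odot> x) = cnj c \<odot> star A x"
    and star_mult: "x \<in> carrier A \<Longrightarrow> y \<in> carrier A \<Longrightarrow> star A (x \<otimes> y) = star A y \<otimes> star A x"
    and nrm_ge_0: "x \<in> carrier A \<Longrightarrow> 0 \<le> nrm A x"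
    and nrm_eq_0: "x \<in> carrier A \<Longrightarrow> nrm A x = 0 \<longleftrightarrow> x = \<zero>"
    and nrm_add: "x \<in> carrier A \<Longrightarrow> y \<in> carrier A \<Longrightarrow> nrm A (x \<oplus> y) \<le> nrm A x + nrm A y"
    and nrm_smult: "x \<in> carrier A \<Longrightarrow> nrm A (c \<odot> x) = cmod c * nrm A x"
    and nrm_mult: "x \<in> carrier A \<Longrightarrow> y \<in> carrier A \<Longrightarrow> nrm A (x \<otimes> y) \<le> nrm A x * nrm A y"
    and nrm_cstar: "x \<in> carrier A \<Longrightarrow> nrm A (star A x \<otimes> x) = (nrm A x)\<^sup>2"
    and complete: "Metric_space.mcomplete (carrier A) (nrm_dist A)"

definition lin_span :: "('a, 'm) star_alg_scheme \<Rightarrow> 'a set \<Rightarrow> 'a set" where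
  "lin_span A S =
     {finsum A (\<lambda>s. c s \<odot>\<^bsub>A\<^esub> s) T | T c. finite T \<and> T \<subseteq> S}"

text \<open>
  States are the positive linear functionals of norm one; for a positive functional on a unital
  C*-algebra the norm is the value at the unit.
\<close>

definition state :: "('a, 'm) star_alg_scheme \<Rightarrow> ('a \<Rightarrow> complex) \<Rightarrow> bool" where
  "state A \<phi> \<longleftrightarrow>
     (\<forall>x\<in>carrier A. \<forall>y\<in>carrier A. \<phi> (x \<oplus>\<^bsub>A\<^esub> y) = \<phi> x + \<phi> y) \<and>
     (\<forall>c. \<forall>x\<in>carrier A. \<phi> (c \<odot>\<^bsub>A\<^esub> x) = c * \<phi> x) \<and>
     (\<forall>x\<in>carrier A. \<phi> (star A x \<otimes>\<^bsub>A\<^esub> x) \<in> \<real>\<^sub>\<ge>\<^sub>0) \<and>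
     (\<forall>x\<in>carrier A. cmod (\<phi> x) \<le> nrm A x) \<and>
     \<phi> \<one>\<^bsub>A\<^esub> = 1"

text \<open>
  The quotient by an ideal: the factor ring of the library, with the induced scalar
  multiplication and involution and the quotient norm. (A closed ideal of a C*-algebra is
  invariant under the involution, so the union in \<open>star\<close> is over equal cosets.)
\<close>

definition quotient_alg :: "('a, 'm) star_alg_scheme \<Rightarrow> 'a set \<Rightarrow> 'a set star_alg" where
  "quotient_alg A I =
     \<lparr>carrier = carrier (A Quot I), mult = mult (A Quot I), one = one (A Quot I),
      zero = zero (A Quot I), add = add (A Quot I),
      smult = (\<lambda>c X. \<Union>x\<in>X. I +>\<^bsub>A\<^esub> (c \<odot>\<^bsub>A\<^esub> x)),
      star = (\<lambda>X. \<Union>x\<in>X. I +>\<^bsub>A\<^esub> star A x),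
      nrm = (\<lambda>X. INF x\<in>X. nrm A x)\<rparr>"

section \<open>Completion\<close>

text \<open>
  The Hausdorff completion of an algebra with respect to a seminorm stored in the field
  \<open>nrm\<close>: Cauchy sequences modulo null sequences.
\<close>

definition cauchy_seqs :: "('p, 'm) star_alg_scheme \<Rightarrow> (nat \<Rightarrow> 'p) set" where
  "cauchy_seqs P =
     {X. (\<forall>n. X n \<in> carrier P) \<and>
         (\<forall>e>0. \<exists>N. \<forall>m\<ge>N. \<forall>n\<ge>N. nrm P (X m \<ominus>\<^bsub>P\<^esub> X n) < e)}"

definition null_rel :: "('p, 'm) star_alg_scheme \<Rightarrow> ((nat \<Rightarrow> 'p) \<times> (nat \<Rightarrow> 'p)) set" where
  "null_rel P =
     {(X, Y). X \<in> cauchy_seqs P \<and> Y \<in> cauchy_seqs P \<and>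
              (\<lambda>n. nrm P (X n \<ominus>\<^bsub>P\<^esub> Y n)) \<longlonglongrightarrow> 0}"

definition seq_class :: "('p, 'm) star_alg_scheme \<Rightarrow> (nat \<Rightarrow> 'p) \<Rightarrow> (nat \<Rightarrow> 'p) set" where
  "seq_class P X = null_rel P `` {X}"

definition completion :: "('p, 'm) star_alg_scheme \<Rightarrow> (nat \<Rightarrow> 'p) set star_alg" where
  "completion P =
     \<lparr>carrier = cauchy_seqs P // null_rel P,
      mult = (\<lambda>U V. \<Union>X\<in>U. \<Union>Y\<in>V. seq_class P (\<lambda>n. X n \<otimes>\<^bsub>P\<^esub> Y n)),
      one = seq_class P (\<lambda>n. \<one>\<^bsub>P\<^esub>),
      zero = seq_class P (\<lambda>n. \<zero>\<^bsub>P\<^esub>),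
      add = (\<lambda>U V. \<Union>X\<in>U. \<Union>Y\<in>V. seq_class P (\<lambda>n. X n \<oplus>\<^bsub>P\<^esub> Y n)),
      smult = (\<lambda>c U. \<Union>X\<in>U. seq_class P (\<lambda>n. c \<odot>\<^bsub>P\<^esub> X n)),
      star = (\<lambda>U. \<Union>X\<in>U. seq_class P (\<lambda>n. star P (X n))),
      nrm = (\<lambda>U. THE r. \<forall>X\<in>U. (\<lambda>n. nrm P (X n)) \<longlonglongrightarrow> r)\<rparr>"

section \<open>The infinite free product\<close>

text \<open>
  The unital universal free product is the enveloping C*-algebra of the unital *-algebra
  generated by symbols \<open>(j, a)\<close>, subject to the relations making each
  \<open>a \<mapsto> (j, a)\<close> a unital *-homomorphism. Elements of the free algebra are finitely
  supported complex functions on words, multiplied by convolution.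
\<close>

datatype 'l free_monoid = Word (letters: "'l list")

instantiation free_monoid :: (type) monoid_add
begin

definition zero_free_monoid :: "'a free_monoid" where
  "zero_free_monoid = Word []"

definition plus_free_monoid :: "'a free_monoid \<Rightarrow> 'a free_monoid \<Rightarrow> 'a free_monoid" where
  "plus_free_monoid v w = Word (letters v @ letters w)"

instance
  by standard (simp_all add: zero_free_monoid_def plus_free_monoid_def)

end

type_synonym 'a free_poly = "(nat \<times> 'a) free_monoid \<Rightarrow>\<^sub>0 complex"

definition gen :: "nat \<Rightarrow> 'a \<Rightarrow> 'a free_poly" where
  "gen j a = Poly_Mapping.single (Word [(j, a)]) 1"

definition free_carrier :: "('a, 'm) star_alg_scheme \<Rightarrow> 'a free_poly set" where
  "free_carrier A =
     {x. \<forall>w \<in> Poly_Mapping.keys x. snd ` set (letters w) \<subseteq> carrier A}"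

definition free_smult :: "complex \<Rightarrow> 'a free_poly \<Rightarrow> 'a free_poly" where
  "free_smult c x = Poly_Mapping.single 0 c * x"

text \<open>Conjugate-linear and antimultiplicative, with \<open>(j, a)\<close> sent to \<open>(j, star a)\<close>.\<close>

definition free_star :: "('a, 'm) star_alg_scheme \<Rightarrow> 'a free_poly \<Rightarrow> 'a free_poly" where
  "free_star A x =
     (\<Sum>w \<in> Poly_Mapping.keys x.
        Poly_Mapping.single (Word (rev (map (\<lambda>(j, a). (j, star A a)) (letters w))))
          (cnj (Poly_Mapping.lookup x w)))"

text \<open>
  The C*-seminorms on the free *-algebra which respect the relations of the free product. The
  bound on generators holds automatically, because C*-seminorms on a C*-algebra are dominated by
  its norm; it makes the supremum below visibly finite.
\<close>

definition free_cstar_seminorm ::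
    "('a, 'm) star_alg_scheme \<Rightarrow> ('a free_poly \<Rightarrow> real) \<Rightarrow> bool" where
  "free_cstar_seminorm A p \<longleftrightarrow>
     (\<forall>x\<in>free_carrier A. 0 \<le> p x) \<and>
     (\<forall>x\<in>free_carrier A. \<forall>y\<in>free_carrier A. p (x + y) \<le> p x + p y) \<and>
     (\<forall>c. \<forall>x\<in>free_carrier A. p (free_smult c x) = cmod c * p x) \<and>
     (\<forall>x\<in>free_carrier A. \<forall>y\<in>free_carrier A. p (x * y) \<le> p x * p y) \<and>
     (\<forall>x\<in>free_carrier A. p (free_star A x * x) = (p x)\<^sup>2) \<and>
     (\<forall>j. \<forall>a\<in>carrier A. \<forall>b\<in>carrier A. p (gen j (a \<oplus>\<^bsub>A\<^esub> b) - (gen j a + gen j b)) = 0) \<and>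
     (\<forall>j. \<forall>c. \<forall>a\<in>carrier A. p (gen j (c \<odot>\<^bsub>A\<^esub> a) - free_smult c (gen j a)) = 0) \<and>
     (\<forall>j. \<forall>a\<in>carrier A. \<forall>b\<in>carrier A. p (gen j (a \<otimes>\<^bsub>A\<^esub> b) - gen j a * gen j b) = 0) \<and>
     (\<forall>j. p (gen j \<one>\<^bsub>A\<^esub> - 1) = 0) \<and>
     (\<forall>j. \<forall>a\<in>carrier A. p (gen j a) \<le> nrm A a)"

definition free_star_alg :: "('a, 'm) star_alg_scheme \<Rightarrow> 'a free_poly star_alg" where
  "free_star_alg A =
     \<lparr>carrier = free_carrier A, mult = (*), one = 1, zero = 0, add = (+),
      smult = free_smult, star = free_star A,
      nrm = (\<lambda>x. SUP p\<in>{p. free_cstar_seminorm A p}. p x)\<rparr>"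

type_synonym 'a free_product_elem = "(nat \<Rightarrow> 'a free_poly) set"

definition free_product :: "('a, 'm) star_alg_scheme \<Rightarrow> 'a free_product_elem star_alg" where
  "free_product A = completion (free_star_alg A)"

definition emb :: "('a, 'm) star_alg_scheme \<Rightarrow> nat \<Rightarrow> 'a \<Rightarrow> 'a free_product_elem" where
  "emb A j a = seq_class (free_star_alg A) (\<lambda>n. gen j a)"

definition monomial :: "('a, 'm) star_alg_scheme \<Rightarrow> (nat \<times> 'a) list \<Rightarrow> 'a free_product_elem" where
  "monomial A w =
     foldr (\<lambda>(j, a) x. emb A j a \<otimes>\<^bsub>free_product A\<^esub> x) w \<one>\<^bsub>free_product A\<^esub>"

text \<open>
  The *-endomorphism of the free product with \<open>emb A j a \<mapsto> emb A (f j) a\<close>: it relabels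
  the letters of each term of a representing Cauchy sequence.
\<close>

definition relabel :: "(nat \<Rightarrow> nat) \<Rightarrow> 'a free_poly \<Rightarrow> 'a free_poly" where
  "relabel f x =
     (\<Sum>w \<in> Poly_Mapping.keys x.
        Poly_Mapping.single (Word (map (\<lambda>(j, a). (f j, a)) (letters w)))
          (Poly_Mapping.lookup x w))"

definition index_endo ::
    "('a, 'm) star_alg_scheme \<Rightarrow> (nat \<Rightarrow> nat) \<Rightarrow> 'a free_product_elem \<Rightarrow> 'a free_product_elem" where
  "index_endo A f U = (\<Union>X\<in>U. seq_class (free_star_alg A) (\<lambda>n. relabel f (X n)))"

definition finitary_perms :: "(nat \<Rightarrow> nat) set" where
  "finitary_perms = {\<sigma>. bij \<sigma> \<and> finite {k. \<sigma> k \<noteq> k}}"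

definition ordered_monomials ::
    "('a, 'm) star_alg_scheme \<Rightarrow> 'a free_product_elem set \<Rightarrow> 'a free_product_elem set set" where
  "ordered_monomials A I =
     {I +>\<^bsub>free_product A\<^esub> monomial A w | w.
        snd ` set w \<subseteq> carrier A \<and>
        (sorted_wrt (<) (map fst w) \<or> sorted_wrt (>) (map fst w))}"

section \<open>Quantum stochastic processes\<close>

text \<open>The inner product is linear in its first argument.\<close>

class chilbert_space = real_inner + banach +
  fixes scaleC :: "complex \<Rightarrow> 'a \<Rightarrow> 'a" (infixr \<open>*\<^sub>C\<close> 75)
    and cinner :: "'a \<Rightarrow> 'a \<Rightarrow> complex"
  assumes scaleR_scaleC: "r *\<^sub>R x = complex_of_real r *\<^sub>C x"
    and scaleC_add_right: "c *\<^sub>C (x + y) = c *\<^sub>C x + c *\<^sub>C y"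
    and scaleC_add_left: "(c + d) *\<^sub>C x = c *\<^sub>C x + d *\<^sub>C x"
    and scaleC_scaleC: "c *\<^sub>C d *\<^sub>C x = (c * d) *\<^sub>C x"
    and cinner_commute: "cinner x y = cnj (cinner y x)"
    and cinner_add_left: "cinner (x + y) z = cinner x z + cinner y z"
    and cinner_scaleC_left: "cinner (c *\<^sub>C x) y = c * cinner x y"
    and inner_Re_cinner: "inner x y = Re (cinner x y)"

definition bounded_ops :: "('h::chilbert_space \<Rightarrow> 'h) set" where
  "bounded_ops = {T. bounded_linear T \<and> (\<forall>c x. T (c *\<^sub>C x) = c *\<^sub>C T x)}"

definition commutant :: "('h::chilbert_space \<Rightarrow> 'h) set \<Rightarrow> ('h \<Rightarrow> 'h) set" where
  "commutant S = {T \<in> bounded_ops. \<forall>R\<in>S. T \<circ> R = R \<circ> T}"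

definition unital_star_rep ::
    "('a, 'm) star_alg_scheme \<Rightarrow> ('a \<Rightarrow> 'h::chilbert_space \<Rightarrow> 'h) \<Rightarrow> bool" where
  "unital_star_rep A \<pi> \<longleftrightarrow>
     (\<forall>a\<in>carrier A. \<pi> a \<in> bounded_ops) \<and>
     (\<forall>a\<in>carrier A. \<forall>b\<in>carrier A. \<forall>x. \<pi> (a \<oplus>\<^bsub>A\<^esub> b) x = \<pi> a x + \<pi> b x) \<and>
     (\<forall>c. \<forall>a\<in>carrier A. \<forall>x. \<pi> (c \<odot>\<^bsub>A\<^esub> a) x = c *\<^sub>C \<pi> a x) \<and>
     (\<forall>a\<in>carrier A. \<forall>b\<in>carrier A. \<pi> (a \<otimes>\<^bsub>A\<^esub> b) = \<pi> a \<circ> \<pi> b) \<and>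
     (\<forall>a\<in>carrier A. \<forall>x y. cinner (\<pi> a x) y = cinner x (\<pi> (star A a) y)) \<and>
     \<pi> \<one>\<^bsub>A\<^esub> = id"

text \<open>
  The von Neumann algebra generated by the ranges of the representations, a set closed under
  adjoints, is its double commutant.
\<close>

definition quantum_stochastic_process ::
    "('a, 'm) star_alg_scheme \<Rightarrow> (nat \<Rightarrow> 'a \<Rightarrow> 'h::chilbert_space \<Rightarrow> 'h) \<Rightarrow> 'h \<Rightarrow> bool" where
  "quantum_stochastic_process A \<iota> \<xi> \<longleftrightarrow>
     (\<forall>j. unital_star_rep A (\<iota> j)) \<and>
     norm \<xi> = 1 \<and>
     closure ((\<lambda>T. T \<xi>) ` commutant (commutant (\<Union>j. \<iota> j ` carrier A))) = UNIV"

definition distribution ::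
    "('a, 'm) star_alg_scheme \<Rightarrow> (nat \<Rightarrow> 'a \<Rightarrow> 'h::chilbert_space \<Rightarrow> 'h) \<Rightarrow> 'h \<Rightarrow>
     ('a free_product_elem \<Rightarrow> complex) \<Rightarrow> bool" where
  "distribution A \<iota> \<xi> \<phi> \<longleftrightarrow>
     state (free_product A) \<phi> \<and>
     (\<forall>w. snd ` set w \<subseteq> carrier A \<and> distinct_adj (map fst w) \<longrightarrow>
        \<phi> (monomial A w) = cinner (foldr (\<lambda>(j, a). \<iota> j a) w \<xi>) \<xi>)"

definition exchangeable ::
    "('a, 'm) star_alg_scheme \<Rightarrow> ('a free_product_elem \<Rightarrow> complex) \<Rightarrow> bool" where
  "exchangeable A \<phi> \<longleftrightarrow>
     (\<forall>\<sigma>\<in>finitary_perms. \<forall>x\<in>carrier (free_product A). \<phi> (index_endo A \<sigma> x) = \<phi> x)"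

definition spreadable ::
    "('a, 'm) star_alg_scheme \<Rightarrow> ('a free_product_elem \<Rightarrow> complex) \<Rightarrow> bool" where
  "spreadable A \<phi> \<longleftrightarrow>
     (\<forall>f. strict_mono f \<longrightarrow> (\<forall>x\<in>carrier (free_product A). \<phi> (index_endo A f x) = \<phi> x))"

definition factorizes_through ::
    "('a, 'm) star_alg_scheme \<Rightarrow> 'a free_product_elem set \<Rightarrow>
     ('a free_product_elem \<Rightarrow> complex) \<Rightarrow> bool" where
  "factorizes_through A I \<phi> \<longleftrightarrow>
     (\<exists>\<psi>. state (quotient_alg (free_product A) I) \<psi> \<and>
          (\<forall>x\<in>carrier (free_product A). \<phi> x = \<psi> (I +>\<^bsub>free_product A\<^esub> x)))"

end

theory Submission
  imports Defs "HOL-Combinatorics.Permutations"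
begin

text \<open>
  An increasing map agrees with a finitary permutation on any finite set of indices, so an
  exchangeable state is spreadable on the dense subalgebra of polynomials, hence everywhere.

  Conversely, a spreadable state is invariant under permuting the indices of a monomial whose
  indices are pairwise distinct. It suffices to interchange two indices \<open>j\<close> and \<open>j + 1\<close>: spreadability
  lets one letter run through a long gap below or above the other, and in the representation
  the averages of the resulting vectors over both halves of the gap become close in norm, as
  in von Neumann's mean ergodic theorem. As \<open>\<phi>\<close> vanishes on the invariant ideal \<open>I\<close>,
  \<open>\<phi> \<circ> \<alpha>\<^sub>\<sigma> - \<phi>\<close> is a bounded functional that descends to the quotient and vanishes on the ordered
  monomials, so it is zero.
\<close>

section \<open>Complex inner products\<close>

text \<open>Ordered monomials enter only through having pairwise distinct indices. This is what lets
  a single letter be moved: another occurrence of its index would have to move along, and in general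
  the moment would no longer be the inner product of a moving vector with a fixed one. A permutation
  need not keep a monomial ordered, so invariance is proved for all words with distinct indices, as
  a statement about moments, before the quotient is considered. No limit of averages is formed.
  Signs -1 on the lower half of the gap and +1 on the upper half give a vector whose norm is
  computed exactly, and its inner product with the fixed vector is the gap length times the defect;
  letting the gap grow forces the defect to vanish. Elements of the free product are classes of
  Cauchy sequences, and its norm comes from a supremum of seminorms. Both density arguments
  therefore rest on one fact: relabelling indices does not increase the norm.\<close>

lemma cinner_scaleC_right: "cinner x (c *\<^sub>C y) = cnj c * cinner x (y :: 'h::chilbert_space)"
  by (metis cinner_commute cinner_scaleC_left complex_cnj_mult)

lemma cinner_scaleR_left: "cinner (r *\<^sub>R x) y = of_real r * cinner x (y :: 'h::chilbert_space)"
  by (simp add: cinner_scaleC_left scaleR_scaleC)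

lemma cinner_zero_left: "cinner 0 (y :: 'h::chilbert_space) = 0"
  using cinner_add_left[of 0 0 y] by simp

lemma cinner_sum_left: "cinner (sum f K) (y :: 'h::chilbert_space) = (\<Sum>k\<in>K. cinner (f k) y)"
  by (induction K rule: infinite_finite_induct) (simp_all add: cinner_zero_left cinner_add_left)

lemma norm_scaleC: "norm (c *\<^sub>C x) = cmod c * norm (x :: 'h::chilbert_space)"
proof -
  have "cinner (c *\<^sub>C x) (c *\<^sub>C x) = complex_of_real ((cmod c)\<^sup>2) * cinner x x"
    unfolding cinner_scaleC_left cinner_scaleC_right
    by (simp only: complex_norm_square mult_ac)
  then have "(norm (c *\<^sub>C x))\<^sup>2 = (cmod c * norm x)\<^sup>2"
    by (simp add: power2_norm_eq_inner inner_Re_cinner power_mult_distrib)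
  then show ?thesis
    by (simp add: power2_eq_iff_nonneg)
qed

text \<open>A unimodular factor on \<open>x\<close> makes the complex inner product real and
  nonnegative, so the Cauchy-Schwarz inequality of the underlying real inner product space
  applies.\<close>

lemma cmod_cinner_le: "cmod (cinner x y) \<le> norm x * norm (y :: 'h::chilbert_space)"
proof -
  obtain c where c: "cmod c = 1" "cinner x y = complex_of_real (cmod (cinner x y)) * c"
  proof (cases "cinner x y = 0")
    case True
    then show ?thesis using that[of 1] by simp
  next
    case False
    then show ?thesis
      using that[of "cinner x y / cmod (cinner x y)"] by (simp add: norm_divide)
  qed
  have "cnj c * c = 1"
    using c(1) by (metis complex_norm_square mult.commute of_real_1 power_one)
  then have "cinner (cnj c *\<^sub>C x) y = complex_of_real (cmod (cinner x y))"
    by (subst cinner_scaleC_left, subst c(2)) (simp add: mult.left_commute)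
  then have "cmod (cinner x y) = inner (cnj c *\<^sub>C x) y"
    by (simp add: inner_Re_cinner)
  also have "\<dots> \<le> norm (cnj c *\<^sub>C x) * norm y"
    by (rule norm_cauchy_schwarz)
  finally show ?thesis
    by (simp add: norm_scaleC c(1))
qed

text \<open>The Gram matrix is \<open>d - r\<close> times the identity plus \<open>r\<close> times
  the all-ones matrix. Weights of sum zero kill the second part, so with weights of modulus one the
  squared norm grows only linearly in the number of vectors.\<close>

lemma norm_sum_equicorrelated:
  fixes v :: "'k \<Rightarrow> 'h::real_inner"
  assumes "finite K"
    and inner: "\<And>k l. k \<in> K \<Longrightarrow> l \<in> K \<Longrightarrow> inner (v k) (v l) = (if k = l then d else r)"
  shows "(norm (\<Sum>k\<in>K. \<epsilon> k *\<^sub>R v k))\<^sup>2 = (d - r) * (\<Sum>k\<in>K. (\<epsilon> k)\<^sup>2) + r * (\<Sum>k\<in>K. \<epsilon> k)\<^sup>2"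
proof -
  have "(norm (\<Sum>k\<in>K. \<epsilon> k *\<^sub>R v k))\<^sup>2 = (\<Sum>k\<in>K. \<Sum>l\<in>K. \<epsilon> k * \<epsilon> l * inner (v k) (v l))"
    by (simp add: power2_norm_eq_inner inner_sum_left inner_sum_right sum_distrib_left
        inner_commute mult.assoc mult.left_commute)
  also have "\<dots> = (\<Sum>k\<in>K. \<Sum>l\<in>K. (if k = l then (d - r) * (\<epsilon> k * \<epsilon> l) else 0) + r * (\<epsilon> k * \<epsilon> l))"
    by (intro sum.cong refl) (simp add: inner algebra_simps)
  also have "\<dots> = (d - r) * (\<Sum>k\<in>K. (\<epsilon> k)\<^sup>2) + r * (\<Sum>k\<in>K. \<epsilon> k)\<^sup>2"
    using \<open>finite K\<close>
    by (simp add: sum.distrib sum_distrib_left[symmetric] power2_eq_square sum_product)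
  finally show ?thesis .
qed

section \<open>Moments of a spreadable process\<close>

locale star_reps = unital_cstar_algebra A for A :: "('a, 'm) star_alg_scheme" (structure) +
  fixes \<iota> :: "nat \<Rightarrow> 'a \<Rightarrow> 'h::chilbert_space \<Rightarrow> 'h" and \<xi> :: 'h
  assumes rep: "unital_star_rep A (\<iota> j)"
begin

definition word_op :: "(nat \<times> 'a) list \<Rightarrow> 'h \<Rightarrow> 'h" where
  "word_op w = foldr (\<lambda>(j, a). \<iota> j a) w"

definition moment :: "(nat \<times> 'a) list \<Rightarrow> complex" where
  "moment w = cinner (word_op w \<xi>) \<xi>"

definition word_adj :: "(nat \<times> 'a) list \<Rightarrow> (nat \<times> 'a) list" where
  "word_adj w = rev (map (apsnd (star A)) w)"

definition words :: "(nat \<times> 'a) list set" where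
  "words = {w. snd ` set w \<subseteq> carrier A}"

lemma words_simps [simp]:
  "[] \<in> words" "(j, a) # w \<in> words \<longleftrightarrow> a \<in> carrier A \<and> w \<in> words"
  "u @ w \<in> words \<longleftrightarrow> u \<in> words \<and> w \<in> words"
  by (auto simp: words_def)

lemma word_op_simps [simp]:
  "word_op [] v = v" "word_op ((j, a) # w) v = \<iota> j a (word_op w v)"
  "word_op (u @ w) v = word_op u (word_op w v)"
  by (simp_all add: word_op_def)

lemma \<iota>_one [simp]: "\<iota> j \<one> v = v"
  using rep by (simp add: unital_star_rep_def)

lemma \<iota>_mult: "a \<in> carrier A \<Longrightarrow> b \<in> carrier A \<Longrightarrow> \<iota> j (a \<otimes> b) v = \<iota> j a (\<iota> j b v)"
  using rep by (simp add: unital_star_rep_def)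

lemma \<iota>_adj: "a \<in> carrier A \<Longrightarrow> cinner (\<iota> j a x) y = cinner x (\<iota> j (star A a) y)"
  using rep by (simp add: unital_star_rep_def)

lemma word_adj_simps [simp]:
  "word_adj [] = []" "word_adj ((j, a) # w) = word_adj w @ [(j, star A a)]"
  "word_adj (u @ w) = word_adj w @ word_adj u"
  by (simp_all add: word_adj_def)

lemma word_adj_words [simp]: "w \<in> words \<Longrightarrow> word_adj w \<in> words"
  by (auto simp: words_def word_adj_def star_closed)

lemma map_apfst_word_adj: "map (apfst f) (word_adj w) = word_adj (map (apfst f) w)"
  by (simp add: word_adj_def rev_map)

lemma map_apfst_words [simp]: "map (apfst f) w \<in> words \<longleftrightarrow> w \<in> words"
  by (simp add: words_def image_image)

lemma cinner_word_op: "w \<in> words \<Longrightarrow> cinner (word_op w x) y = cinner x (word_op (word_adj w) y)"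
  by (induction w arbitrary: y) (auto simp: \<iota>_adj star_closed)

text \<open>Every inner product of word vectors is a moment, so invariance of moments turns into
  invariance of norms and angles in the Hilbert space.\<close>

lemma cinner_word_op_word_op:
  assumes "u \<in> words" "w \<in> words"
  shows "cinner (word_op u \<xi>) (word_op w \<xi>) = moment (word_adj w @ u)"
proof -
  have "cinner (word_op w \<xi>) (word_op u \<xi>) = cinner \<xi> (word_op (word_adj w) (word_op u \<xi>))"
    by (rule cinner_word_op[OF assms(2)])
  then show ?thesis
    unfolding moment_def word_op_simps by (metis cinner_commute)
qed

end

text \<open>Only words with distinct neighbouring indices are assumed to be invariant, since a
  distribution is prescribed on those words alone.\<close>

locale spreadable_reps = star_reps +
  assumes moment_strict_mono':
    "strict_mono f \<Longrightarrow> w \<in> words \<Longrightarrow> distinct_adj (map fst w) \<Longrightarrow>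
       moment (map (apfst f) w) = moment w"
begin

text \<open>Inner products of word vectors lead to words such as \<open>word_adj w @ w\<close>,
  whose middle letters share an index. Two neighbours with the same index can be merged by
  multiplying their elements of \<open>A\<close>. This changes neither the moment nor the relabelled
  moment and shortens the word, whence the induction on length.\<close>

lemma moment_strict_mono:
  assumes f: "strict_mono f" and "w \<in> words"
  shows "moment (map (apfst f) w) = moment w"
  using assms(2)
proof (induction "length w" arbitrary: w rule: less_induct)
  case less
  show ?case
  proof (cases "distinct_adj (map fst w)")
    case True
    then show ?thesis using moment_strict_mono'[OF f less.prems] by simp
  next
    case False
    then obtain i where i: "Suc i < length w" "fst (w ! i) = fst (w ! Suc i)"
      by (auto simp: distinct_adj_conv_nth)
    define u v j a b where uv: "u = take i w" "v = drop (Suc (Suc i)) w"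
      "j = fst (w ! i)" "a = snd (w ! i)" "b = snd (w ! Suc i)"
    have w: "w = u @ (j, a) # (j, b) # v"
      using i unfolding uv by (metis Cons_nth_drop_Suc Suc_lessD append_take_drop_id prod.collapse)
    define w' where "w' = u @ (j, a \<otimes> b) # v"
    have ab: "a \<in> carrier A" "b \<in> carrier A" and w': "w' \<in> words" "length w' < length w"
      using less.prems unfolding w w'_def by auto
    have "moment (map (apfst f) w) = moment (map (apfst f) w')"
      by (simp add: moment_def w w'_def \<iota>_mult[OF ab])
    also have "\<dots> = moment w'"
      using less.hyps w' by blast
    also have "\<dots> = moment w"
      by (simp add: moment_def w w'_def \<iota>_mult[OF ab])
    finally show ?thesis .
  qed
qed

lemma norm_word_op_strict_mono:
  assumes "strict_mono f" "w \<in> words"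
  shows "norm (word_op (map (apfst f) w) \<xi>) = norm (word_op w \<xi>)"
proof -
  have "cinner (word_op (map (apfst f) w) \<xi>) (word_op (map (apfst f) w) \<xi>) =
      cinner (word_op w \<xi>) (word_op w \<xi>)"
    using moment_strict_mono[OF assms(1), of "word_adj w @ w"] assms(2)
      word_adj_words[OF assms(2)]
    by (simp add: cinner_word_op_word_op map_apfst_word_adj)
  then show ?thesis
    by (simp add: norm_eq_sqrt_inner inner_Re_cinner)
qed

text \<open>
  Both sides are unchanged if the letters other than \<open>b\<close> are fixed with a gap around \<open>j + N\<close>,
  and \<open>b\<close> is averaged over positions above or below \<open>j + N\<close>. The vectors
  arising from the different positions of \<open>b\<close> have a common norm and a common real inner product,
  so the two averages are \<open>O(1 / sqrt N)\<close>-close.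
\<close>

lemma moment_swap:
  assumes XYZ: "X \<in> words" "Y \<in> words" "Z \<in> words" and ab: "a \<in> carrier A" "b \<in> carrier A"
    and avoid: "{j, Suc j} \<inter> fst ` set (X @ Y @ Z) = {}"
  shows "moment (X @ (j, a) # Y @ (Suc j, b) # Z) = moment (X @ (Suc j, a) # Y @ (j, b) # Z)"
    (is "?c = ?c'")
proof -
  define e where "e = norm (word_op (word_adj (X @ (j, a) # Y)) \<xi>)"
  define d where "d = (norm (word_op ((j, b) # Z) \<xi>))\<^sup>2"
  define r where "r = Re (cinner (word_op ((j, b) # Z) \<xi>) (word_op ((Suc j, b) # Z) \<xi>))"
  \<comment> \<open>The right-hand side does not depend on \<open>N\<close>, so a nonzero defect is
    excluded by taking \<open>N\<close> large.\<close>
  have bound: "real N * (cmod (?c - ?c'))\<^sup>2 \<le> e\<^sup>2 * (2 * (d - r))" if "N > 0" for N :: nat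
  proof -
    \<comment> \<open>\<open>f p q\<close> opens a gap after \<open>j\<close>: the indices
      \<open>j\<close> and \<open>Suc j\<close> go to the offsets \<open>p\<close> and
      \<open>q\<close> inside it, and all larger indices are pushed out by \<open>2 * N\<close>. On
      the remaining letters its effect \<open>h\<close> does not depend on \<open>p\<close> and
      \<open>q\<close>.\<close>
    define f where "f p q i = (if i < j then i else if i = j then j + p else if i = Suc j then j + q
      else i + 2 * N)" for p q i
    define h where "h W = map (apfst (\<lambda>i. if i < j then i else i + 2 * N)) W" for W :: "(nat \<times> 'a) list"
    \<comment> \<open>The word is cut in front of \<open>b\<close>. The vector \<open>v q\<close>
      carries \<open>b\<close> at offset \<open>q\<close> followed by the fixed tail, and
      \<open>\<eta>\<close> comes from the adjoint of everything in front, with \<open>a\<close>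
      parked at the middle offset \<open>N\<close>.\<close>
    define v where "v q = word_op ((j + q, b) # h Z) \<xi>" for q
    define \<eta> where "\<eta> = word_op (word_adj (h X @ (j + N, a) # h Y)) \<xi>"
    \<comment> \<open>Indices from \<open>j + 2\<close> on land at \<open>j + 2 * N + 2\<close> or
      later, so offsets up to \<open>2 * N + 1\<close> are free. The letter \<open>b\<close> uses
      offsets up to \<open>2 * N\<close>; the last one is an image for \<open>Suc j\<close> when
      only the letter at \<open>j\<close> is being moved.\<close>
    have f: "strict_mono (f p q)" if "p < q" "q \<le> Suc (2 * N)" for p q
      using that by (auto simp: f_def strict_mono_def)
    have fW: "map (apfst (f p q)) W = h W" if "set W \<subseteq> set (X @ Y @ Z)" for p q W
      using that avoid unfolding h_def f_def by (force simp: apfst_def)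
    have fXYZ: "map (apfst (f p q)) X = h X" "map (apfst (f p q)) Y = h Y"
      "map (apfst (f p q)) Z = h Z" for p q
      by (rule fW; auto)+
    have f_j: "f p q j = j + p" "f p q (Suc j) = j + q" for p q
      by (simp_all add: f_def)
    have h_words: "h W \<in> words" if "W \<in> words" for W
      using that by (simp add: h_def)
    have pair: "cinner (v q) \<eta> = moment (h X @ (j + N, a) # h Y @ (j + q, b) # h Z)" for q
    proof -
      have "cinner (v q) \<eta> = cnj (cinner \<eta> (v q))"
        by (rule cinner_commute)
      also have "\<dots> = cinner (word_op (h X @ (j + N, a) # h Y) (v q)) \<xi>"
        unfolding \<eta>_def
        by (metis XYZ(1,2) ab(1) cinner_commute cinner_word_op h_words words_simps(2,3))
      finally show ?thesis
        by (simp add: moment_def v_def)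
    qed
    \<comment> \<open>By spreadability the pairing depends only on the side of \<open>a\<close> on
      which \<open>b\<close> lies: above gives \<open>?c\<close>, below gives
      \<open>?c'\<close>.\<close>
    have upper: "cinner (v q) \<eta> = ?c" if "N < q" "q \<le> Suc (2 * N)" for q
      using moment_strict_mono[OF f[OF that], of "X @ (j, a) # Y @ (Suc j, b) # Z"] XYZ ab
      by (simp add: pair fXYZ f_j)
    have lower: "cinner (v q) \<eta> = ?c'" if "q < N" for q
      using moment_strict_mono[OF f[OF that], of "X @ (Suc j, a) # Y @ (j, b) # Z"] XYZ ab
      by (simp add: pair fXYZ f_j)
    have norm_v: "inner (v q) (v q) = d" if "q \<le> 2 * N" for q
      using norm_word_op_strict_mono[OF f[of q "Suc (2 * N)"], of "(j, b) # Z"] that XYZ ab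
      by (simp add: v_def d_def fXYZ f_j power2_norm_eq_inner[symmetric])
    \<comment> \<open>Only the real part is common to all pairs: exchanging \<open>p\<close> and
      \<open>q\<close> conjugates the complex inner product.\<close>
    have inner_v: "inner (v p) (v q) = r" if "p < q" "q \<le> 2 * N" for p q
    proof -
      have "cinner (v p) (v q) = moment (map (apfst (f p q)) (word_adj ((Suc j, b) # Z) @ (j, b) # Z))"
        unfolding v_def using XYZ ab h_words
        by (subst cinner_word_op_word_op) (simp_all add: fXYZ f_j map_apfst_word_adj)
      also have "\<dots> = moment (word_adj ((Suc j, b) # Z) @ (j, b) # Z)"
        by (rule moment_strict_mono[OF f]) (use that XYZ ab in \<open>simp_all add: star_closed\<close>)
      also have "\<dots> = cinner (word_op ((j, b) # Z) \<xi>) (word_op ((Suc j, b) # Z) \<xi>)"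
        using XYZ ab by (subst cinner_word_op_word_op) simp_all
      finally show ?thesis
        by (simp add: r_def inner_Re_cinner)
    qed
    have norm_\<eta>: "norm \<eta> = e"
      using norm_word_op_strict_mono[OF f[of N "Suc (2 * N)"], of "word_adj (X @ (j, a) # Y)"] XYZ ab
      by (simp add: e_def \<eta>_def map_apfst_word_adj fXYZ f_j star_closed)
    \<comment> \<open>The offset \<open>N\<close> is left out because \<open>a\<close> occupies it.
      There remain \<open>N\<close> offsets on each side, so the signs \<open>\<epsilon>\<close> sum
      to zero and the \<open>r\<close> term of \<open>norm_sum_equicorrelated\<close> drops
      out.\<close>
    define K where "K = {..<N} \<union> {N<..2*N}"
    define \<epsilon> where "\<epsilon> q = (if q < N then -1 else 1 :: real)" for q
    have sum_\<epsilon>: "(\<Sum>q\<in>K. g (\<epsilon> q)) = (\<Sum>q<N. g (-1)) + (\<Sum>q\<in>{N<..2*N}. g 1)"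
      for g :: "real \<Rightarrow> real"
      unfolding K_def by (subst sum.union_disjoint) (auto simp: \<epsilon>_def)
    have "(norm (\<Sum>q\<in>K. \<epsilon> q *\<^sub>R v q))\<^sup>2 = (d - r) * (\<Sum>q\<in>K. (\<epsilon> q)\<^sup>2) + r * (\<Sum>q\<in>K. \<epsilon> q)\<^sup>2"
    proof (rule norm_sum_equicorrelated)
      fix p q assume "p \<in> K" "q \<in> K"
      then have "p \<le> 2 * N" "q \<le> 2 * N"
        by (auto simp: K_def)
      then show "inner (v p) (v q) = (if p = q then d else r)"
        using norm_v inner_v by (metis inner_commute linorder_neqE_nat)
    qed (simp add: K_def)
    also have "\<dots> = 2 * real N * (d - r)"
      using sum_\<epsilon>[of "\<lambda>x. x\<^sup>2"] sum_\<epsilon>[of "\<lambda>x. x"] by simp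
    finally have norm_sum: "(norm (\<Sum>q\<in>K. \<epsilon> q *\<^sub>R v q))\<^sup>2 = 2 * real N * (d - r)" .
    have "cinner (\<Sum>q\<in>K. \<epsilon> q *\<^sub>R v q) \<eta> = (\<Sum>q\<in>K. of_real (\<epsilon> q) * cinner (v q) \<eta>)"
      by (simp add: cinner_sum_left cinner_scaleR_left)
    also have "\<dots> = (\<Sum>q<N. - ?c') + (\<Sum>q\<in>{N<..2*N}. ?c)"
      unfolding K_def by (subst sum.union_disjoint) (auto simp: \<epsilon>_def upper lower)
    also have "\<dots> = of_nat N * (?c - ?c')"
      by (simp add: algebra_simps)
    finally have "real N * cmod (?c - ?c') \<le> norm (\<Sum>q\<in>K. \<epsilon> q *\<^sub>R v q) * e"
      using cmod_cinner_le[of "\<Sum>q\<in>K. \<epsilon> q *\<^sub>R v q" \<eta>] by (simp add: norm_mult norm_\<eta>)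
    \<comment> \<open>The square is quadratic in \<open>N\<close> on the left and linear in
      \<open>N\<close> on the right; cancelling one factor leaves the claimed bound.\<close>
    then have "(real N * cmod (?c - ?c'))\<^sup>2 \<le> (norm (\<Sum>q\<in>K. \<epsilon> q *\<^sub>R v q) * e)\<^sup>2"
      by (intro power_mono) simp_all
    then have "real N * (real N * (cmod (?c - ?c'))\<^sup>2) \<le> real N * (e\<^sup>2 * (2 * (d - r)))"
      by (simp add: power_mult_distrib norm_sum power2_eq_square[of "real N"] mult_ac)
    then show ?thesis
      using that by (simp only: mult_le_cancel_left_pos of_nat_0_less_iff)
  qed
  show ?thesis
  proof (rule ccontr)
    assume "?c \<noteq> ?c'"
    then have "(cmod (?c - ?c'))\<^sup>2 > 0"
      by simp
    then obtain N :: nat where "e\<^sup>2 * (2 * (d - r)) < real N * (cmod (?c - ?c'))\<^sup>2"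
      using ex_less_of_nat_mult by blast
    also have "\<dots> \<le> real (Suc N) * (cmod (?c - ?c'))\<^sup>2"
      by (intro mult_right_mono) simp_all
    also have "\<dots> \<le> e\<^sup>2 * (2 * (d - r))"
      by (rule bound) simp
    finally show False
      by simp
  qed
qed

section \<open>From adjacent transpositions to all finitary permutations\<close>

definition exch :: "(nat \<Rightarrow> nat) set" where
  "exch = {\<sigma>. bij \<sigma> \<and>
     (\<forall>w\<in>words. distinct (map fst w) \<longrightarrow> moment (map (apfst \<sigma>) w) = moment w)}"

text \<open>Injectivity, contained in \<open>exch\<close>, keeps the indices distinct after
  relabelling by \<open>\<tau>\<close>, so that \<open>\<sigma>\<close> may be applied to the
  relabelled word.\<close>

lemma exch_comp: "\<sigma> \<in> exch \<Longrightarrow> \<tau> \<in> exch \<Longrightarrow> \<sigma> \<circ> \<tau> \<in> exch"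
proof -
  assume \<sigma>: "\<sigma> \<in> exch" and \<tau>: "\<tau> \<in> exch"
  have "moment (map (apfst (\<sigma> \<circ> \<tau>)) w) = moment w" if "w \<in> words" "distinct (map fst w)" for w
  proof -
    have "map fst (map (apfst \<tau>) w) = map \<tau> (map fst w)"
      by simp
    moreover have "inj_on \<tau> B" for B
      using \<tau> by (auto simp: exch_def bij_def intro: inj_on_subset)
    ultimately have "distinct (map fst (map (apfst \<tau>) w))"
      using that(2) by (simp only: distinct_map[of \<tau>] simp_thms)
    then have "moment (map (apfst \<sigma>) (map (apfst \<tau>) w)) = moment w"
      using \<sigma> \<tau> that by (simp add: exch_def del: map_map)
    then show ?thesis
      by (simp add: apfst_compose comp_def)
  qed
  then show ?thesis
    using \<sigma> \<tau> by (simp add: exch_def bij_comp)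
qed

text \<open>In a word with distinct indices containing both \<open>j\<close> and
  \<open>Suc j\<close>, either one may come first; these two cases are the two sides of
  \<open>moment_swap\<close>. The names \<open>k\<close> and \<open>l\<close> in
  \<open>ordered\<close> stand for the two indices in order of occurrence, so both cases are treated
  together.\<close>

lemma transpose_Suc_exch: "Transposition.transpose j (Suc j) \<in> exch"
proof -
  let ?\<tau> = "Transposition.transpose j (Suc j)"
  have ordered: "moment (map (apfst ?\<tau>) w) = moment w"
    if w: "w = X @ (k, a) # Y @ (l, b) # Z" and kl: "{k, l} = {j, Suc j}"
      and "w \<in> words" "distinct (map fst w)" for w X Y Z k l a b
  proof -
    have "k \<noteq> l" and avoid: "{k, l} \<inter> fst ` set (X @ Y @ Z) = {}"
      using that by auto
    have "apfst ?\<tau> x = x" if "x \<in> set (X @ Y @ Z)" for x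
      using avoid that kl by (cases x) (force simp: Transposition.transpose_def)
    then have fixed: "map (apfst ?\<tau>) W = W" if "set W \<subseteq> set (X @ Y @ Z)" for W
      using that by (intro map_idI) blast
    have \<tau>w: "map (apfst ?\<tau>) w = X @ (l, a) # Y @ (k, b) # Z"
      using kl \<open>k \<noteq> l\<close> fixed[of X] fixed[of Y] fixed[of Z]
      by (auto simp: w doubleton_eq_iff)
    show ?thesis
      using kl \<open>k \<noteq> l\<close> avoid \<open>w \<in> words\<close> moment_swap[of X Y Z a b j] unfolding \<tau>w
      by (auto simp: w doubleton_eq_iff)
  qed
  have both: "moment (map (apfst ?\<tau>) w) = moment w"
    if w: "w \<in> words" "distinct (map fst w)" and mem: "j \<in> fst ` set w" "Suc j \<in> fst ` set w" for w
  proof -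
    obtain a U V where U: "w = U @ (j, a) # V"
      using mem(1) by (metis (no_types, lifting) imageE prod.collapse split_list)
    then consider "Suc j \<in> fst ` set U" | "Suc j \<in> fst ` set V"
      using mem(2) by auto
    then show ?thesis
    proof cases
      case 1
      then obtain b U' Y where "U = U' @ (Suc j, b) # Y"
        by (metis (no_types, lifting) imageE prod.collapse split_list)
      then show ?thesis
        using ordered[of w U' "Suc j" b Y j a V] U w by auto
    next
      case 2
      then obtain b Y Z where "V = Y @ (Suc j, b) # Z"
        by (metis (no_types, lifting) imageE prod.collapse split_list)
      then show ?thesis
        using ordered[of w U j a Y "Suc j" b Z] U w by auto
    qed
  qed
  have "moment (map (apfst ?\<tau>) w) = moment w" if w: "w \<in> words" "distinct (map fst w)" for w
  proof -
    \<comment> \<open>Padding with unit letters makes both indices occur without changing any moment.\<close>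
    define pad where "pad = map (\<lambda>i. (i, \<one>)) (filter (\<lambda>i. i \<notin> fst ` set w) [j, Suc j])"
    have pad_op: "word_op (map (apfst \<sigma>) pad) v = v" "word_op pad v = v" for \<sigma> v
      by (simp_all add: pad_def)
    have "moment (map (apfst ?\<tau>) (w @ pad)) = moment (w @ pad)"
      by (rule both) (use w in \<open>auto simp: pad_def\<close>)
    then show ?thesis
      by (simp add: moment_def pad_op)
  qed
  then show ?thesis
    by (simp add: exch_def)
qed

text \<open>The transposition of \<open>j\<close> and \<open>Suc k\<close> is the conjugate of that
  of \<open>j\<close> and \<open>k\<close> by the adjacent transposition of \<open>k\<close> and
  \<open>Suc k\<close>.\<close>

lemma transpose_exch: "j < k \<Longrightarrow> Transposition.transpose j k \<in> exch"
proof (induction k)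
  case (Suc k)
  show ?case
  proof (cases "j = k")
    case False
    then have "Transposition.transpose j (Suc k) =
        Transposition.transpose k (Suc k) \<circ> Transposition.transpose j k \<circ>
        Transposition.transpose k (Suc k)"
      using Suc.prems by (auto simp: Transposition.transpose_def fun_eq_iff)
    with Suc False show ?thesis
      by (metis exch_comp less_antisym transpose_Suc_exch)
  qed (simp add: transpose_Suc_exch)
qed simp

lemma finitary_perms_exch:
  assumes "\<sigma> \<in> finitary_perms"
  shows "\<sigma> \<in> exch"
proof -
  have "\<sigma> permutes {k. \<sigma> k \<noteq> k}" "finite {k. \<sigma> k \<noteq> k}"
    using assms by (auto simp: finitary_perms_def permutes_def bij_iff)
  then show ?thesis
  proof (induction rule: permutes_induct)
    case id
    show ?case by (simp add: exch_def apfst_id[unfolded id_def] bij_id[unfolded id_def])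
  next
    case (swap a b p)
    then show ?case
      by (metis exch_comp linorder_neqE_nat Transposition.transpose_commute transpose_exch)
  qed
qed

end

section \<open>Seminorms on the free *-algebra\<close>

definition rename_letters :: "(nat \<Rightarrow> nat) \<Rightarrow> (nat \<times> 'a) free_monoid \<Rightarrow> (nat \<times> 'a) free_monoid" where
  "rename_letters f w = Word (map (apfst f) (letters w))"

lemma rename_letters_Word [simp]: "rename_letters f (Word w) = Word (map (apfst f) w)"
  by (simp add: rename_letters_def)

lemma Word_Nil [simp]: "Word [] = 0"
  and letters_zero [simp]: "letters 0 = []"
  and letters_plus [simp]: "letters (v + w) = letters v @ letters w"
  by (simp_all add: zero_free_monoid_def plus_free_monoid_def)

lemma rename_letters_zero [simp]: "rename_letters f 0 = 0"
  by (simp add: rename_letters_def)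

lemma letters_rename_letters [simp]: "letters (rename_letters f w) = map (apfst f) (letters w)"
  by (simp add: rename_letters_def)

lemma rename_letters_plus: "rename_letters f (v + w) = rename_letters f v + rename_letters f w"
  by (simp add: rename_letters_def plus_free_monoid_def)

lemma poly_mapping_sum_single:
  "(\<Sum>w\<in>Poly_Mapping.keys x. Poly_Mapping.single w (Poly_Mapping.lookup x w)) = x"
proof (rule poly_mapping_eqI)
  fix k
  show "Poly_Mapping.lookup (\<Sum>w\<in>Poly_Mapping.keys x. Poly_Mapping.single w (Poly_Mapping.lookup x w)) k
      = Poly_Mapping.lookup x k"
    by (simp add: lookup_sum lookup_single when_def sum.delta in_keys_iff)
qed

text \<open>Polynomials are finite sums of single terms. Identities additive in each argument, such
  as multiplicativity of \<open>relabel\<close>, thereby reduce to identities between words.\<close>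

lemma poly_mapping_induct_sum [case_names zero single add]:
  fixes x :: "'k \<Rightarrow>\<^sub>0 'c::comm_monoid_add"
  assumes "P 0" "\<And>k c. P (Poly_Mapping.single k c)" "\<And>x y. P x \<Longrightarrow> P y \<Longrightarrow> P (x + y)"
  shows "P x"
proof -
  have "P (\<Sum>w\<in>K. Poly_Mapping.single w (Poly_Mapping.lookup x w))" if "finite K" for K
    using that by (induction K) (auto intro: assms)
  then show ?thesis
    using poly_mapping_sum_single[of x] by (metis finite_keys)
qed

text \<open>Cancellation can make the support of \<open>x + y\<close> smaller than the union of the
  supports. Summing over that union is harmless, because the extra terms are
  \<open>g k 0\<close>.\<close>

lemma sum_keys_add:
  fixes g :: "'k \<Rightarrow> 'c::comm_monoid_add \<Rightarrow> 'd::comm_monoid_add"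
  assumes g: "\<And>k. g k 0 = 0" "\<And>k c d. g k (c + d) = g k c + g k d"
  shows "(\<Sum>k\<in>Poly_Mapping.keys (x + y). g k (Poly_Mapping.lookup (x + y) k)) =
     (\<Sum>k\<in>Poly_Mapping.keys x. g k (Poly_Mapping.lookup x k)) +
     (\<Sum>k\<in>Poly_Mapping.keys y. g k (Poly_Mapping.lookup y k))"
proof -
  let ?K = "Poly_Mapping.keys x \<union> Poly_Mapping.keys y"
  have "(\<Sum>k\<in>Poly_Mapping.keys z. g k (Poly_Mapping.lookup z k)) = (\<Sum>k\<in>?K. g k (Poly_Mapping.lookup z k))"
    if "Poly_Mapping.keys z \<subseteq> ?K" for z
    using that by (intro sum.mono_neutral_left) (auto simp: in_keys_iff g)
  from this[OF keys_add] this[OF Un_upper1] this[OF Un_upper2] show ?thesis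
    by (simp add: lookup_add g sum.distrib)
qed

lemma relabel_alt:
  "relabel f x = (\<Sum>w\<in>Poly_Mapping.keys x.
     Poly_Mapping.single (rename_letters f w) (Poly_Mapping.lookup x w))"
  by (simp add: relabel_def rename_letters_def apfst_def map_prod_def)

lemma relabel_single [simp]:
  "relabel f (Poly_Mapping.single w c) = Poly_Mapping.single (rename_letters f w) c"
  by (simp add: relabel_alt)

lemma relabel_zero [simp]: "relabel f 0 = 0"
  by (simp add: relabel_alt)

lemma relabel_add: "relabel f (x + y) = relabel f x + relabel f y"
  unfolding relabel_alt by (rule sum_keys_add) (simp_all add: single_add)

lemma relabel_one [simp]: "relabel f 1 = 1"
  using relabel_single[of f 0 1] by (simp del: relabel_single)

lemma relabel_mult: "relabel f (x * y) = relabel f x * relabel f y"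
proof (induction x rule: poly_mapping_induct_sum)
  case (single v c)
  show ?case
  proof (induction y rule: poly_mapping_induct_sum)
    case (single w d)
    show ?case by (simp add: mult_single rename_letters_plus)
  qed (simp_all add: relabel_add distrib_left)
qed (simp_all add: relabel_add distrib_right)

lemma relabel_smult: "relabel f (free_smult c x) = free_smult c (relabel f x)"
  by (simp add: free_smult_def relabel_mult)

lemma relabel_diff: "relabel f (x - y) = relabel f x - relabel f y"
  by (metis add_diff_cancel diff_add_cancel relabel_add)

lemma relabel_gen [simp]: "relabel f (gen j a) = gen (f j) a"
  by (simp add: gen_def)

text \<open>A polynomial involves finitely many indices, and only the values of \<open>f\<close>
  there matter. This is what allows an increasing map to be replaced by a finitary
  permutation.\<close>

lemma relabel_cong:
  assumes "\<And>w j a. w \<in> Poly_Mapping.keys x \<Longrightarrow> (j, a) \<in> set (letters w) \<Longrightarrow> f j = g j"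
  shows "relabel f x = relabel g x"
  unfolding relabel_alt rename_letters_def
  by (intro sum.cong arg_cong2[where f = Poly_Mapping.single] arg_cong[where f = Word] map_cong refl)
    (auto intro: assms)

lemma free_star_single [simp]:
  "free_star A (Poly_Mapping.single w c) =
     Poly_Mapping.single (Word (rev (map (apsnd (star A)) (letters w)))) (cnj c)"
  by (simp add: free_star_def apsnd_def map_prod_def)

lemma free_star_zero [simp]: "free_star A 0 = 0"
  by (simp add: free_star_def)

lemma free_star_add: "free_star A (x + y) = free_star A x + free_star A y"
  unfolding free_star_def by (rule sum_keys_add) (simp_all add: single_add)

lemma relabel_free_star: "relabel f (free_star A x) = free_star A (relabel f x)"
  by (induction x rule: poly_mapping_induct_sum)
    (simp_all add: relabel_add free_star_add rename_letters_def rev_map comp_def case_prod_beta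
      apfst_def apsnd_def map_prod_def)

section \<open>Polynomials with letters in \<open>A\<close> and the universal C*-seminorm\<close>

context unital_cstar_algebra
begin

abbreviation "free_alg \<equiv> free_carrier A"

definition good_word :: "(nat \<times> 'a) free_monoid \<Rightarrow> bool" where
  "good_word w \<longleftrightarrow> snd ` set (letters w) \<subseteq> carrier A"

lemma free_alg_iff: "x \<in> free_alg \<longleftrightarrow> (\<forall>w\<in>Poly_Mapping.keys x. good_word w)"
  by (simp add: free_carrier_def good_word_def)

lemma free_alg_zero [simp]: "0 \<in> free_alg"
  by (simp add: free_alg_iff)

lemma free_alg_single [simp]: "good_word w \<Longrightarrow> Poly_Mapping.single w c \<in> free_alg"
  by (simp add: free_alg_iff)

lemma free_alg_one [simp]: "1 \<in> free_alg"
  by (simp add: free_alg_iff good_word_def)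

lemma free_alg_gen [simp]: "a \<in> carrier A \<Longrightarrow> gen j a \<in> free_alg"
  by (simp add: gen_def good_word_def)

lemma free_alg_add [simp]: "x \<in> free_alg \<Longrightarrow> y \<in> free_alg \<Longrightarrow> x + y \<in> free_alg"
  using keys_add[of x y] by (auto simp: free_alg_iff)

lemma free_alg_mult [simp]:
  assumes "x \<in> free_alg" "y \<in> free_alg"
  shows "x * y \<in> free_alg"
proof -
  have "good_word w" if w: "w \<in> Poly_Mapping.keys (x * y)" for w
  proof -
    obtain u v where "w = u + v" "u \<in> Poly_Mapping.keys x" "v \<in> Poly_Mapping.keys y"
      using keys_mult[of x y] w by blast
    then show ?thesis
      using assms by (auto simp: free_alg_iff good_word_def image_Un)
  qed
  then show ?thesis by (simp add: free_alg_iff)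
qed

lemma free_alg_smult [simp]: "x \<in> free_alg \<Longrightarrow> free_smult c x \<in> free_alg"
  unfolding free_smult_def by (intro free_alg_mult free_alg_single) (simp_all add: good_word_def)

lemma free_smult_minus_one: "free_smult (-1) x = - x"
  by (simp add: free_smult_def single_uminus)

lemma free_alg_uminus [simp]: "x \<in> free_alg \<Longrightarrow> - x \<in> free_alg"
  using free_alg_smult[of x "-1"] by (simp add: free_smult_minus_one)

lemma free_alg_diff [simp]: "x \<in> free_alg \<Longrightarrow> y \<in> free_alg \<Longrightarrow> x - y \<in> free_alg"
  using free_alg_add[of x "- y"] by simp

lemma free_alg_sum [simp]: "(\<And>i. i \<in> K \<Longrightarrow> g i \<in> free_alg) \<Longrightarrow> sum g K \<in> free_alg"
  by (induction K rule: infinite_finite_induct) simp_all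

lemma free_alg_relabel [simp]:
  assumes "x \<in> free_alg"
  shows "relabel f x \<in> free_alg"
  unfolding relabel_alt
  by (intro free_alg_sum free_alg_single) (use assms in \<open>auto simp: free_alg_iff good_word_def image_image rename_letters_def\<close>)

text \<open>Makes the family of seminorms nonempty, as bounding its supremum from above requires,
  and gives nonnegativity of that supremum.\<close>

lemma free_cstar_seminorm_zero: "free_cstar_seminorm A (\<lambda>x. 0)"
  by (simp add: free_cstar_seminorm_def nrm_ge_0)

text \<open>\<open>relabel f\<close> is a unital *-homomorphism that maps generators to generators
  with the same element of \<open>A\<close>, so pulling back along it respects every defining
  condition. The supremum norm is therefore contracted by relabelling.\<close>

lemma free_cstar_seminorm_relabel:
  assumes "free_cstar_seminorm A p"
  shows "free_cstar_seminorm A (\<lambda>x. p (relabel f x))"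
  using assms
  by (simp add: free_cstar_seminorm_def relabel_add relabel_smult relabel_mult relabel_diff
      relabel_free_star)

text \<open>A real supremum is meaningful only over a bounded set. Submultiplicativity and the bound
  on generators dominate a word by the product of the norms of its letters, and a polynomial by the
  weighted sum of these products.\<close>

lemma free_cstar_seminorm_bounded:
  assumes "x \<in> free_alg"
  shows "\<exists>B. \<forall>p. free_cstar_seminorm A p \<longrightarrow> p x \<le> B"
proof -
  have p_word: "p (Poly_Mapping.single (Word w) 1) \<le> (\<Prod>(j, a)\<leftarrow>w. nrm A a)"
    if p: "free_cstar_seminorm A p" and "snd ` set w \<subseteq> carrier A" for p w
    using that(2)
  proof (induction w)
    case Nil
    \<comment> \<open>The C*-identity at the unit forces \<open>p 1\<close> to be 0 or 1, hence at
      most the empty product.\<close>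
    have "p (free_star A 1 * 1) = (p 1)\<^sup>2"
      using p free_alg_one unfolding free_cstar_seminorm_def by blast
    moreover have "free_star A 1 = 1"
      using free_star_single[of A 0 1] by (simp del: free_star_single)
    ultimately have "p 1 = p 1 * p 1"
      by (simp add: power2_eq_square)
    then show ?case
      by auto
  next
    case (Cons l w)
    obtain j a where l: "l = (j, a)" by fastforce
    have a: "a \<in> carrier A" and w: "Poly_Mapping.single (Word w) 1 \<in> free_alg"
      using Cons.prems by (auto simp: l good_word_def)
    have "Poly_Mapping.single (Word (l # w)) 1 = gen j a * Poly_Mapping.single (Word w) 1"
      by (simp add: l gen_def mult_single plus_free_monoid_def)
    then have "p (Poly_Mapping.single (Word (l # w)) 1) \<le> p (gen j a) * p (Poly_Mapping.single (Word w) 1)"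
      using p a w free_alg_gen unfolding free_cstar_seminorm_def by metis
    also have "\<dots> \<le> nrm A a * (\<Prod>(j, a)\<leftarrow>w. nrm A a)"
      using p a w Cons nrm_ge_0 unfolding free_cstar_seminorm_def
      by (intro mult_mono) auto
    finally show ?case by (simp add: l)
  qed
  define B where "B K = (\<Sum>w\<in>K. cmod (Poly_Mapping.lookup x w) * (\<Prod>(j, a)\<leftarrow>letters w. nrm A a))" for K
  have "p (\<Sum>w\<in>K. Poly_Mapping.single w (Poly_Mapping.lookup x w)) \<le> B K"
    if p: "free_cstar_seminorm A p" and "finite K" "K \<subseteq> Poly_Mapping.keys x" for p K
    using that(2,3)
  proof (induction K)
    case empty
    have "p (free_smult 0 0) = 0"
      using p free_alg_zero unfolding free_cstar_seminorm_def by (metis mult_zero_left norm_zero)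
    then show ?case by (simp add: B_def free_smult_def)
  next
    case (insert w K)
    have good: "good_word v" if "v \<in> insert w K" for v
      using insert.prems assms that by (auto simp: free_alg_iff)
    have w: "Poly_Mapping.single w (Poly_Mapping.lookup x w) =
        free_smult (Poly_Mapping.lookup x w) (Poly_Mapping.single (Word (letters w)) 1)"
      by (simp add: free_smult_def mult_single)
    have "p (Poly_Mapping.single w (Poly_Mapping.lookup x w)) \<le>
        cmod (Poly_Mapping.lookup x w) * (\<Prod>(j, a)\<leftarrow>letters w. nrm A a)"
    proof -
      have "p (Poly_Mapping.single w (Poly_Mapping.lookup x w)) =
          cmod (Poly_Mapping.lookup x w) * p (Poly_Mapping.single (Word (letters w)) 1)"
        unfolding w using p good[of w] unfolding free_cstar_seminorm_def by simp
      then show ?thesis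
        using p_word[OF p, of "letters w"] good[of w] by (simp add: good_word_def mult_left_mono)
    qed
    moreover have "p (Poly_Mapping.single w (Poly_Mapping.lookup x w) +
          (\<Sum>w\<in>K. Poly_Mapping.single w (Poly_Mapping.lookup x w)))
        \<le> p (Poly_Mapping.single w (Poly_Mapping.lookup x w)) +
          p (\<Sum>w\<in>K. Poly_Mapping.single w (Poly_Mapping.lookup x w))"
      using p good unfolding free_cstar_seminorm_def by simp
    ultimately show ?case
      using insert by (simp add: B_def)
  qed
  then show ?thesis
    by (metis finite_keys order_refl poly_mapping_sum_single)
qed

definition free_norm :: "'a free_poly \<Rightarrow> real" where
  "free_norm = nrm (free_star_alg A)"

lemma free_norm_eq_SUP: "free_norm x = (SUP p\<in>{p. free_cstar_seminorm A p}. p x)"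
  by (simp add: free_norm_def free_star_alg_def)

lemma free_norm_upper:
  assumes "free_cstar_seminorm A p" "x \<in> free_alg"
  shows "p x \<le> free_norm x"
proof -
  obtain B where B: "\<And>p. free_cstar_seminorm A p \<Longrightarrow> p x \<le> B"
    using free_cstar_seminorm_bounded[OF assms(2)] by blast
  show ?thesis
    unfolding free_norm_eq_SUP by (rule cSUP_upper) (use assms(1) B in \<open>auto intro!: bdd_aboveI[of _ B]\<close>)
qed

lemma free_norm_least:
  assumes "\<And>p. free_cstar_seminorm A p \<Longrightarrow> p x \<le> B"
  shows "free_norm x \<le> B"
  unfolding free_norm_eq_SUP by (rule cSUP_least) (use assms free_cstar_seminorm_zero in auto)

lemma free_norm_ge_0: "x \<in> free_alg \<Longrightarrow> 0 \<le> free_norm x"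
  using free_norm_upper[OF free_cstar_seminorm_zero] by simp

lemma free_norm_zero [simp]: "free_norm 0 = 0"
proof (rule antisym)
  show "free_norm 0 \<le> 0"
  proof (rule free_norm_least)
    fix p assume p: "free_cstar_seminorm A p"
    have "p (free_smult 0 0) = 0"
      using p free_alg_zero unfolding free_cstar_seminorm_def by (metis mult_zero_left norm_zero)
    then show "p 0 \<le> 0" by (simp add: free_smult_def)
  qed
qed (simp add: free_norm_ge_0)

lemma free_norm_add: "x \<in> free_alg \<Longrightarrow> y \<in> free_alg \<Longrightarrow> free_norm (x + y) \<le> free_norm x + free_norm y"
proof (rule free_norm_least)
  fix p assume xy: "x \<in> free_alg" "y \<in> free_alg" and p: "free_cstar_seminorm A p"
  have "p (x + y) \<le> p x + p y"
    using p xy unfolding free_cstar_seminorm_def by blast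
  also have "\<dots> \<le> free_norm x + free_norm y"
    using free_norm_upper p xy by (intro add_mono) auto
  finally show "p (x + y) \<le> free_norm x + free_norm y" .
qed

lemma free_norm_mult: "x \<in> free_alg \<Longrightarrow> y \<in> free_alg \<Longrightarrow> free_norm (x * y) \<le> free_norm x * free_norm y"
proof (rule free_norm_least)
  fix p assume xy: "x \<in> free_alg" "y \<in> free_alg" and p: "free_cstar_seminorm A p"
  have "0 \<le> p y" "p (x * y) \<le> p x * p y"
    using p xy unfolding free_cstar_seminorm_def by blast+
  note this(2)
  also have "p x * p y \<le> free_norm x * free_norm y"
    using free_norm_upper p xy free_norm_ge_0 \<open>0 \<le> p y\<close> by (intro mult_mono) auto
  finally show "p (x * y) \<le> free_norm x * free_norm y" .
qed

lemma free_norm_smult_le: "x \<in> free_alg \<Longrightarrow> free_norm (free_smult c x) \<le> cmod c * free_norm x"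
proof (rule free_norm_least)
  fix p assume x: "x \<in> free_alg" and p: "free_cstar_seminorm A p"
  have "p (free_smult c x) = cmod c * p x"
    using p x unfolding free_cstar_seminorm_def by blast
  also have "\<dots> \<le> cmod c * free_norm x"
    using free_norm_upper p x by (intro mult_left_mono) auto
  finally show "p (free_smult c x) \<le> cmod c * free_norm x" .
qed

lemma free_norm_uminus [simp]:
  assumes "x \<in> free_alg"
  shows "free_norm (- x) = free_norm x"
  using free_norm_smult_le[of x "-1"] free_norm_smult_le[of "- x" "-1"] assms
  by (simp add: free_smult_minus_one)

lemma free_norm_commute: "x \<in> free_alg \<Longrightarrow> y \<in> free_alg \<Longrightarrow> free_norm (x - y) = free_norm (y - x)"
  using free_norm_uminus[of "x - y"] by simp

lemma free_norm_relabel: "x \<in> free_alg \<Longrightarrow> free_norm (relabel f x) \<le> free_norm x"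
  by (rule free_norm_least) (rule free_norm_upper[OF free_cstar_seminorm_relabel])

lemma free_norm_triangle:
  "x \<in> free_alg \<Longrightarrow> y \<in> free_alg \<Longrightarrow> z \<in> free_alg \<Longrightarrow> free_norm (x - z) \<le> free_norm (x - y) + free_norm (y - z)"
  using free_norm_add[of "x - y" "y - z"] by simp

lemma free_norm_diff_abs: "x \<in> free_alg \<Longrightarrow> y \<in> free_alg \<Longrightarrow> \<bar>free_norm x - free_norm y\<bar> \<le> free_norm (x - y)"
  using free_norm_add[of "x - y" y] free_norm_add[of "y - x" x] free_norm_commute[of x y] by simp

text \<open>Subtraction in a ring record is defined through inverses in its additive monoid;
  uniqueness of inverses in an abelian group identifies it with subtraction of polynomials.\<close>

lemma free_star_alg_minus:
  assumes "x \<in> free_alg" "y \<in> free_alg"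
  shows "x \<ominus>\<^bsub>free_star_alg A\<^esub> y = x - y"
proof -
  have "abelian_group (free_star_alg A)"
    by (rule abelian_groupI)
      (auto simp: free_star_alg_def add.assoc add.commute intro!: bexI[of _ "- x" for x])
  then have "\<ominus>\<^bsub>free_star_alg A\<^esub> y = - y"
    using assms by (intro abelian_group.minus_equality) (auto simp: free_star_alg_def)
  then show ?thesis
    by (simp add: a_minus_def free_star_alg_def)
qed

end

section \<open>Algebra of the completion\<close>

context unital_cstar_algebra
begin

abbreviation "cseqs \<equiv> cauchy_seqs (free_star_alg A)"
abbreviation "cls \<equiv> seq_class (free_star_alg A)"
abbreviation "\<F> \<equiv> free_product A"

section \<open>Cauchy sequences of polynomials\<close>

lemma cauchy_seqs_iff:
  "X \<in> cseqs \<longleftrightarrow> (\<forall>n. X n \<in> free_alg) \<and>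
     (\<forall>e>0. \<exists>M. \<forall>m\<ge>M. \<forall>n\<ge>M. free_norm (X m - X n) < e)"
proof -
  have "nrm (free_star_alg A) (X m \<ominus>\<^bsub>free_star_alg A\<^esub> X n) = free_norm (X m - X n)"
    if "\<forall>n. X n \<in> free_alg" for m n
    using that by (simp add: free_norm_def free_star_alg_minus)
  then show ?thesis
    by (auto simp: cauchy_seqs_def free_star_alg_def)
qed

lemma cauchy_seqs_closed [simp]: "X \<in> cseqs \<Longrightarrow> X n \<in> free_alg"
  by (simp add: cauchy_seqs_iff)

lemma cauchy_seqsD: "X \<in> cseqs \<Longrightarrow> e > 0 \<Longrightarrow> \<exists>M. \<forall>m\<ge>M. \<forall>n\<ge>M. free_norm (X m - X n) < e"
  by (simp add: cauchy_seqs_iff)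

lemma null_rel_iff:
  "(X, Y) \<in> null_rel (free_star_alg A) \<longleftrightarrow>
     X \<in> cseqs \<and> Y \<in> cseqs \<and> (\<lambda>n. free_norm (X n - Y n)) \<longlonglongrightarrow> 0"
proof -
  have "nrm (free_star_alg A) (X n \<ominus>\<^bsub>free_star_alg A\<^esub> Y n) = free_norm (X n - Y n)"
    if "X \<in> cseqs" "Y \<in> cseqs" for n
    using that by (simp add: free_norm_def free_star_alg_minus)
  then show ?thesis
    by (auto simp: null_rel_def)
qed

lemma tendsto_zero_le:
  fixes u v :: "nat \<Rightarrow> real"
  assumes "v \<longlonglongrightarrow> 0" "\<And>n. 0 \<le> u n" "\<And>n. u n \<le> v n"
  shows "u \<longlonglongrightarrow> 0"
  by (rule tendsto_sandwich[OF _ _ tendsto_const assms(1)]) (simp_all add: assms)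

lemma equiv_null_rel: "equiv cseqs (null_rel (free_star_alg A))"
proof (rule equivI)
  show "null_rel (free_star_alg A) \<subseteq> cseqs \<times> cseqs"
    by (auto simp: null_rel_iff)
  show "refl_on cseqs (null_rel (free_star_alg A))"
    by (auto simp: refl_on_def null_rel_iff)
  show "sym (null_rel (free_star_alg A))"
    by (rule symI) (simp add: null_rel_iff free_norm_commute)
  show "trans (null_rel (free_star_alg A))"
  proof (rule transI)
    fix X Y Z assume "(X, Y) \<in> null_rel (free_star_alg A)" "(Y, Z) \<in> null_rel (free_star_alg A)"
    then have mem: "X \<in> cseqs" "Y \<in> cseqs" "Z \<in> cseqs"
      and lim: "(\<lambda>n. free_norm (X n - Y n) + free_norm (Y n - Z n)) \<longlonglongrightarrow> 0"
      by (auto simp: null_rel_iff intro: tendsto_add_zero)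
    have "(\<lambda>n. free_norm (X n - Z n)) \<longlonglongrightarrow> 0"
      by (rule tendsto_zero_le[OF lim]) (use mem in \<open>auto intro: free_norm_ge_0 free_norm_triangle\<close>)
    then show "(X, Z) \<in> null_rel (free_star_alg A)"
      by (simp add: null_rel_iff mem)
  qed
qed

lemma cls_eqI: "(X, Y) \<in> null_rel (free_star_alg A) \<Longrightarrow> cls X = cls Y"
  unfolding seq_class_def by (rule equiv_class_eq[OF equiv_null_rel])

lemma cls_eq_iff:
  "X \<in> cseqs \<Longrightarrow> Y \<in> cseqs \<Longrightarrow> cls X = cls Y \<longleftrightarrow> (\<lambda>n. free_norm (X n - Y n)) \<longlonglongrightarrow> 0"
  unfolding seq_class_def by (subst eq_equiv_class_iff[OF equiv_null_rel]) (simp_all add: null_rel_iff)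

lemma const_cseqs [simp]: "x \<in> free_alg \<Longrightarrow> (\<lambda>n. x) \<in> cseqs"
  by (simp add: cauchy_seqs_iff)

lemma lipschitz_cseqs:
  assumes "X \<in> cseqs" "\<And>n. Y n \<in> free_alg" "K \<ge> 0"
    "\<And>m n. free_norm (Y m - Y n) \<le> K * free_norm (X m - X n)"
  shows "Y \<in> cseqs"
  unfolding cauchy_seqs_iff
proof (intro conjI allI impI)
  fix e :: real assume "e > 0"
  \<comment> \<open>Dividing by \<open>K + 1\<close> instead of \<open>K\<close> covers
    \<open>K = 0\<close>.\<close>
  then obtain M where M: "\<And>m n. m \<ge> M \<Longrightarrow> n \<ge> M \<Longrightarrow> free_norm (X m - X n) < e / (K + 1)"
    using cauchy_seqsD[OF assms(1), of "e / (K + 1)"] assms(3) by auto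
  have "free_norm (Y m - Y n) < e" if "m \<ge> M" "n \<ge> M" for m n
  proof -
    have "free_norm (Y m - Y n) \<le> K * free_norm (X m - X n)"
      by (rule assms(4))
    also have "\<dots> \<le> (K + 1) * free_norm (X m - X n)"
      using assms(1) by (intro mult_right_mono) (simp_all add: free_norm_ge_0)
    also have "\<dots> < e"
      using M[OF that] assms(3) by (simp add: field_simps)
    finally show ?thesis .
  qed
  then show "\<exists>M. \<forall>m\<ge>M. \<forall>n\<ge>M. free_norm (Y m - Y n) < e"
    by blast
qed (rule assms)

lemma add_cseqs [simp]:
  assumes "X \<in> cseqs" "Y \<in> cseqs"
  shows "(\<lambda>n. X n + Y n) \<in> cseqs"
  unfolding cauchy_seqs_iff
proof (intro conjI allI impI)
  fix e :: real assume "e > 0"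
  then have "e / 2 > 0"
    by simp
  then obtain M1 M2 where M: "\<And>m n. m \<ge> M1 \<Longrightarrow> n \<ge> M1 \<Longrightarrow> free_norm (X m - X n) < e / 2"
      "\<And>m n. m \<ge> M2 \<Longrightarrow> n \<ge> M2 \<Longrightarrow> free_norm (Y m - Y n) < e / 2"
    using assms[THEN cauchy_seqsD] by meson
  have "free_norm ((X m + Y m) - (X n + Y n)) < e" if "m \<ge> max M1 M2" "n \<ge> max M1 M2" for m n
    using free_norm_add[of "X m - X n" "Y m - Y n"] M(1)[of m n] M(2)[of m n] that assms
    by (simp add: algebra_simps)
  then show "\<exists>M. \<forall>m\<ge>M. \<forall>n\<ge>M. free_norm ((X m + Y m) - (X n + Y n)) < e"
    by blast
qed (use assms in simp)

lemma free_smult_diff: "free_smult c x - free_smult c y = free_smult c (x - y)"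
  by (simp add: free_smult_def right_diff_distrib)

lemma free_smult_add: "free_smult c (x + y) = free_smult c x + free_smult c y"
  by (simp add: free_smult_def distrib_left)

lemma free_smult_one_mult: "free_smult c 1 * x = free_smult c x"
  by (simp add: free_smult_def)

lemma smult_cseqs [simp]:
  assumes "X \<in> cseqs"
  shows "(\<lambda>n. free_smult c (X n)) \<in> cseqs"
  by (rule lipschitz_cseqs[OF assms, of _ "cmod c"])
    (use assms in \<open>simp_all add: free_smult_diff free_norm_smult_le\<close>)

lemma uminus_cseqs [simp]: "X \<in> cseqs \<Longrightarrow> (\<lambda>n. - X n) \<in> cseqs"
  using smult_cseqs[of X "-1"] by (simp add: free_smult_minus_one)

lemma diff_cseqs [simp]: "X \<in> cseqs \<Longrightarrow> Y \<in> cseqs \<Longrightarrow> (\<lambda>n. X n - Y n) \<in> cseqs"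
  using add_cseqs[of X "\<lambda>n. - Y n"] by simp

lemma relabel_cseqs [simp]:
  assumes "X \<in> cseqs"
  shows "(\<lambda>n. relabel f (X n)) \<in> cseqs"
  by (rule lipschitz_cseqs[OF assms, of _ 1])
    (use assms in \<open>simp_all add: relabel_diff[symmetric] free_norm_relabel\<close>)

lemma norm_cseqs_convergent:
  assumes "X \<in> cseqs"
  shows "convergent (\<lambda>n. free_norm (X n))"
proof (rule Cauchy_convergent, rule metric_CauchyI)
  fix e :: real assume "e > 0"
  then obtain M where M: "\<And>m n. m \<ge> M \<Longrightarrow> n \<ge> M \<Longrightarrow> free_norm (X m - X n) < e"
    using cauchy_seqsD[OF assms] by blast
  have "dist (free_norm (X m)) (free_norm (X n)) < e" if "m \<ge> M" "n \<ge> M" for m n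
    using free_norm_diff_abs[of "X m" "X n"] M[OF that] assms by (simp add: dist_real_def)
  then show "\<exists>M. \<forall>m\<ge>M. \<forall>n\<ge>M. dist (free_norm (X m)) (free_norm (X n)) < e"
    by blast
qed

lemma norm_cseqs_bounded:
  assumes "X \<in> cseqs"
  obtains B where "B > 0" "\<And>n. free_norm (X n) \<le> B"
proof -
  have "Bseq (\<lambda>n. free_norm (X n))"
    using norm_cseqs_convergent[OF assms] by (rule convergent_imp_Bseq)
  then obtain K where "K > 0" "\<And>n. \<bar>free_norm (X n)\<bar> \<le> K"
    by (auto simp: Bseq_def)
  then show ?thesis
    using that[of K] by (simp add: abs_le_iff)
qed

text \<open>Multiplication is Lipschitz only on bounded sets. The splitting
  \<open>x * (y - y') + (x - x') * y'\<close> needs just one bound for each factor, which Cauchy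
  sequences supply.\<close>

lemma free_norm_mult_diff:
  assumes "x \<in> free_alg" "x' \<in> free_alg" "y \<in> free_alg" "y' \<in> free_alg"
    "free_norm x \<le> B" "free_norm y' \<le> C"
  shows "free_norm (x * y - x' * y') \<le> B * free_norm (y - y') + C * free_norm (x - x')"
proof -
  have "x * y - x' * y' = x * (y - y') + (x - x') * y'"
    by (simp add: algebra_simps)
  then have "free_norm (x * y - x' * y') \<le> free_norm (x * (y - y')) + free_norm ((x - x') * y')"
    using free_norm_add assms by simp
  also have "\<dots> \<le> free_norm x * free_norm (y - y') + free_norm (x - x') * free_norm y'"
    using assms by (intro add_mono free_norm_mult) simp_all
  also have "\<dots> \<le> B * free_norm (y - y') + free_norm (x - x') * C"
    using assms by (intro add_mono mult_mono) (auto intro!: free_norm_ge_0 order.trans[OF free_norm_ge_0])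
  finally show ?thesis by (simp add: mult.commute)
qed

lemma mult_cseqs [simp]:
  assumes "X \<in> cseqs" "Y \<in> cseqs"
  shows "(\<lambda>n. X n * Y n) \<in> cseqs"
  unfolding cauchy_seqs_iff
proof (intro conjI allI impI)
  fix e :: real assume "e > 0"
  obtain B C where BC: "B > 0" "\<And>n. free_norm (X n) \<le> B" "C > 0" "\<And>n. free_norm (Y n) \<le> C"
    using assms[THEN norm_cseqs_bounded] by metis
  have "e / (2 * C) > 0" "e / (2 * B) > 0"
    using BC \<open>e > 0\<close> by simp_all
  then obtain M1 M2 where
      M: "\<And>m n. m \<ge> M1 \<Longrightarrow> n \<ge> M1 \<Longrightarrow> free_norm (X m - X n) < e / (2 * C)"
      "\<And>m n. m \<ge> M2 \<Longrightarrow> n \<ge> M2 \<Longrightarrow> free_norm (Y m - Y n) < e / (2 * B)"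
    using assms[THEN cauchy_seqsD] by meson
  have "free_norm (X m * Y m - X n * Y n) < e" if "m \<ge> max M1 M2" "n \<ge> max M1 M2" for m n
  proof -
    have "free_norm (X m * Y m - X n * Y n) \<le> B * free_norm (Y m - Y n) + C * free_norm (X m - X n)"
      using assms BC by (intro free_norm_mult_diff) simp_all
    also have "\<dots> < B * (e / (2 * B)) + C * (e / (2 * C))"
      using M(1)[of m n] M(2)[of m n] that BC by (intro add_strict_mono mult_strict_left_mono) simp_all
    also have "\<dots> = e"
      using BC by simp
    finally show ?thesis .
  qed
  then show "\<exists>M. \<forall>m\<ge>M. \<forall>n\<ge>M. free_norm (X m * Y m - X n * Y n) < e"
    by blast
qed (use assms in simp)

text \<open>The completion defines its operations as unions over all representatives. If equivalent
  sequences have equivalent images, all sets in the union coincide and one representative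
  suffices.\<close>

lemma UN_cls:
  assumes "X \<in> cseqs"
    and "\<And>X Y. X \<in> cseqs \<Longrightarrow> Y \<in> cseqs \<Longrightarrow> (\<lambda>n. free_norm (X n - Y n)) \<longlonglongrightarrow> 0 \<Longrightarrow>
      (T X, T Y) \<in> null_rel (free_star_alg A)"
  shows "(\<Union>X\<in>cls X. cls (T X)) = cls (T X)"
proof -
  have "(\<lambda>X. cls (T X)) respects null_rel (free_star_alg A)"
    by (intro congruentI cls_eqI assms(2)) (simp_all add: null_rel_iff)
  then show ?thesis
    unfolding seq_class_def[of _ X] by (rule UN_equiv_class[OF equiv_null_rel _ assms(1)])
qed

lemma UN_cls2:
  assumes "X \<in> cseqs" "Y \<in> cseqs"
    and "\<And>X X' Y Y'. X \<in> cseqs \<Longrightarrow> X' \<in> cseqs \<Longrightarrow> Y \<in> cseqs \<Longrightarrow> Y' \<in> cseqs \<Longrightarrow>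
      (\<lambda>n. free_norm (X n - X' n)) \<longlonglongrightarrow> 0 \<Longrightarrow> (\<lambda>n. free_norm (Y n - Y' n)) \<longlonglongrightarrow> 0 \<Longrightarrow>
      (T X Y, T X' Y') \<in> null_rel (free_star_alg A)"
  shows "(\<Union>X\<in>cls X. \<Union>Y\<in>cls Y. cls (T X Y)) = cls (T X Y)"
proof -
  have "congruent2 (null_rel (free_star_alg A)) (null_rel (free_star_alg A)) (\<lambda>X Y. cls (T X Y))"
    by (intro congruent2I' cls_eqI assms(3)) (simp_all add: null_rel_iff)
  then show ?thesis
    unfolding seq_class_def[of _ X] seq_class_def[of _ Y]
    by (rule UN_equiv_class2[OF equiv_null_rel equiv_null_rel _ assms(1,2)])
qed

section \<open>Operations and norm of the free product on representatives\<close>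

lemma carrier_free_product: "carrier \<F> = cls ` cseqs"
  by (auto simp: free_product_def completion_def quotient_def seq_class_def)

lemma cls_closed [simp]: "X \<in> cseqs \<Longrightarrow> cls X \<in> carrier \<F>"
  by (simp add: carrier_free_product)

lemma cls_add:
  assumes "X \<in> cseqs" "Y \<in> cseqs"
  shows "cls X \<oplus>\<^bsub>\<F>\<^esub> cls Y = cls (\<lambda>n. X n + Y n)"
proof -
  have "(\<Union>X\<in>cls X. \<Union>Y\<in>cls Y. cls (\<lambda>n. X n + Y n)) = cls (\<lambda>n. X n + Y n)"
  proof (rule UN_cls2[OF assms])
    fix X X' Y Y' assume mem: "X \<in> cseqs" "X' \<in> cseqs" "Y \<in> cseqs" "Y' \<in> cseqs"
      and "(\<lambda>n. free_norm (X n - X' n)) \<longlonglongrightarrow> 0" "(\<lambda>n. free_norm (Y n - Y' n)) \<longlonglongrightarrow> 0"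
    then have lim: "(\<lambda>n. free_norm (X n - X' n) + free_norm (Y n - Y' n)) \<longlonglongrightarrow> 0"
      by (intro tendsto_add_zero)
    have "(\<lambda>n. free_norm ((X n + Y n) - (X' n + Y' n))) \<longlonglongrightarrow> 0"
      by (rule tendsto_zero_le[OF lim])
        (use mem free_norm_add[of "X n - X' n" "Y n - Y' n" for n] in
          \<open>simp_all add: free_norm_ge_0 algebra_simps\<close>)
    then show "(\<lambda>n. X n + Y n, \<lambda>n. X' n + Y' n) \<in> null_rel (free_star_alg A)"
      using mem by (simp add: null_rel_iff)
  qed
  then show ?thesis
    by (simp add: free_product_def completion_def free_star_alg_def)
qed

lemma cls_mult:
  assumes "X \<in> cseqs" "Y \<in> cseqs"
  shows "cls X \<otimes>\<^bsub>\<F>\<^esub> cls Y = cls (\<lambda>n. X n * Y n)"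
proof -
  have "(\<Union>X\<in>cls X. \<Union>Y\<in>cls Y. cls (\<lambda>n. X n * Y n)) = cls (\<lambda>n. X n * Y n)"
  proof (rule UN_cls2[OF assms])
    fix X X' Y Y' assume mem: "X \<in> cseqs" "X' \<in> cseqs" "Y \<in> cseqs" "Y' \<in> cseqs"
      and lim: "(\<lambda>n. free_norm (X n - X' n)) \<longlonglongrightarrow> 0" "(\<lambda>n. free_norm (Y n - Y' n)) \<longlonglongrightarrow> 0"
    obtain B C where BC: "\<And>n. free_norm (X n) \<le> B" "\<And>n. free_norm (Y' n) \<le> C"
      using norm_cseqs_bounded mem by metis
    have lim': "(\<lambda>n. B * free_norm (Y n - Y' n) + C * free_norm (X n - X' n)) \<longlonglongrightarrow> 0"
      using lim by (intro tendsto_add_zero tendsto_mult_right_zero)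
    have "(\<lambda>n. free_norm (X n * Y n - X' n * Y' n)) \<longlonglongrightarrow> 0"
      by (rule tendsto_zero_le[OF lim']) (use mem BC in \<open>auto intro!: free_norm_ge_0 free_norm_mult_diff\<close>)
    then show "(\<lambda>n. X n * Y n, \<lambda>n. X' n * Y' n) \<in> null_rel (free_star_alg A)"
      using mem by (simp add: null_rel_iff)
  qed
  then show ?thesis
    by (simp add: free_product_def completion_def free_star_alg_def)
qed

lemma cls_smult:
  assumes "X \<in> cseqs"
  shows "c \<odot>\<^bsub>\<F>\<^esub> cls X = cls (\<lambda>n. free_smult c (X n))"
proof -
  have "(\<Union>X\<in>cls X. cls (\<lambda>n. free_smult c (X n))) = cls (\<lambda>n. free_smult c (X n))"
  proof (rule UN_cls[OF assms])
    fix X Y assume mem: "X \<in> cseqs" "Y \<in> cseqs" and "(\<lambda>n. free_norm (X n - Y n)) \<longlonglongrightarrow> 0"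
    then have lim: "(\<lambda>n. cmod c * free_norm (X n - Y n)) \<longlonglongrightarrow> 0"
      by (intro tendsto_mult_right_zero)
    have "(\<lambda>n. free_norm (free_smult c (X n) - free_smult c (Y n))) \<longlonglongrightarrow> 0"
      by (rule tendsto_zero_le[OF lim])
        (use mem in \<open>simp_all add: free_smult_diff free_norm_ge_0 free_norm_smult_le\<close>)
    then show "(\<lambda>n. free_smult c (X n), \<lambda>n. free_smult c (Y n)) \<in> null_rel (free_star_alg A)"
      using mem by (simp add: null_rel_iff)
  qed
  then show ?thesis
    by (simp add: free_product_def completion_def free_star_alg_def)
qed

lemma index_endo_cls:
  assumes "X \<in> cseqs"
  shows "index_endo A f (cls X) = cls (\<lambda>n. relabel f (X n))"
  unfolding index_endo_def
proof (rule UN_cls[OF assms])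
  fix X Y assume mem: "X \<in> cseqs" "Y \<in> cseqs" and lim: "(\<lambda>n. free_norm (X n - Y n)) \<longlonglongrightarrow> 0"
  have "(\<lambda>n. free_norm (relabel f (X n) - relabel f (Y n))) \<longlonglongrightarrow> 0"
    by (rule tendsto_zero_le[OF lim])
      (use mem in \<open>simp_all add: relabel_diff[symmetric] free_norm_ge_0 free_norm_relabel\<close>)
  then show "(\<lambda>n. relabel f (X n), \<lambda>n. relabel f (Y n)) \<in> null_rel (free_star_alg A)"
    using mem by (simp add: null_rel_iff)
qed

lemma cls_one: "\<one>\<^bsub>\<F>\<^esub> = cls (\<lambda>n. 1)"
  and cls_zero: "\<zero>\<^bsub>\<F>\<^esub> = cls (\<lambda>n. 0)"
  by (simp_all add: free_product_def completion_def free_star_alg_def)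

text \<open>The norm is defined as the unique common limit over all representatives. Equivalent
  sequences do have the same limit, since norms differ by at most the norm of the
  difference.\<close>

lemma nrm_cls:
  assumes "X \<in> cseqs"
  shows "(\<lambda>n. free_norm (X n)) \<longlonglongrightarrow> nrm \<F> (cls X)"
proof -
  obtain r where r: "(\<lambda>n. free_norm (X n)) \<longlonglongrightarrow> r"
    using norm_cseqs_convergent[OF assms] by (auto simp: convergent_def)
  have lim: "(\<lambda>n. free_norm (Y n)) \<longlonglongrightarrow> r" if "Y \<in> cls X" for Y
  proof -
    have "Y \<in> cseqs" and null: "(\<lambda>n. free_norm (X n - Y n)) \<longlonglongrightarrow> 0"
      using that by (auto simp: seq_class_def null_rel_iff)
    then have "(\<lambda>n. \<bar>free_norm (X n) - free_norm (Y n)\<bar>) \<longlonglongrightarrow> 0"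
      using assms by (intro tendsto_zero_le[OF null]) (auto intro: free_norm_diff_abs)
    then have "(\<lambda>n. free_norm (X n) - (free_norm (X n) - free_norm (Y n))) \<longlonglongrightarrow> r - 0"
      using r tendsto_rabs_zero_iff by (intro tendsto_diff) blast+
    then show ?thesis by simp
  qed
  have "X \<in> cls X"
    using assms by (simp add: seq_class_def null_rel_iff)
  then have "(THE r. \<forall>X\<in>cls X. (\<lambda>n. free_norm (X n)) \<longlonglongrightarrow> r) = r"
    using lim LIMSEQ_unique by (intro the_equality) blast+
  then show ?thesis
    using r by (simp add: free_product_def completion_def free_norm_def)
qed

section \<open>The free product as a normed group with index endomorphisms\<close>

lemma abelian_group_free_product: "abelian_group \<F>"
proof (rule abelian_groupI)
  fix U assume "U \<in> carrier \<F>"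
  then obtain X where "X \<in> cseqs" "U = cls X"
    by (auto simp: carrier_free_product)
  then show "\<exists>V\<in>carrier \<F>. V \<oplus>\<^bsub>\<F>\<^esub> U = \<zero>\<^bsub>\<F>\<^esub>"
    by (intro bexI[of _ "cls (\<lambda>n. - X n)"]) (simp_all add: cls_add cls_zero)
qed (unfold carrier_free_product cls_zero, auto simp: cls_add add_ac)

lemma cls_uminus:
  assumes "X \<in> cseqs"
  shows "\<ominus>\<^bsub>\<F>\<^esub> cls X = cls (\<lambda>n. - X n)"
  by (rule abelian_group.minus_equality[OF abelian_group_free_product])
    (use assms in \<open>simp_all add: cls_add cls_zero\<close>)

lemma nrm_free_product_ge_0:
  assumes "U \<in> carrier \<F>"
  shows "0 \<le> nrm \<F> U"
proof -
  obtain X where X: "X \<in> cseqs" "U = cls X"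
    using assms by (auto simp: carrier_free_product)
  show ?thesis
    unfolding X(2) by (rule LIMSEQ_le_const[OF nrm_cls]) (use X in \<open>simp_all add: free_norm_ge_0\<close>)
qed

lemma nrm_free_product_eq_0:
  assumes "U \<in> carrier \<F>"
  shows "nrm \<F> U = 0 \<longleftrightarrow> U = \<zero>\<^bsub>\<F>\<^esub>"
proof -
  obtain X where X: "X \<in> cseqs" "U = cls X"
    using assms by (auto simp: carrier_free_product)
  have "nrm \<F> U = 0 \<longleftrightarrow> (\<lambda>n. free_norm (X n)) \<longlonglongrightarrow> 0"
    using nrm_cls[OF X(1)] X(2) by (metis LIMSEQ_unique)
  also have "\<dots> \<longleftrightarrow> cls X = cls (\<lambda>n. 0)"
    using X(1) by (subst cls_eq_iff) simp_all
  finally show ?thesis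
    by (simp add: X cls_zero)
qed

lemma nrm_free_product_add:
  assumes "U \<in> carrier \<F>" "V \<in> carrier \<F>"
  shows "nrm \<F> (U \<oplus>\<^bsub>\<F>\<^esub> V) \<le> nrm \<F> U + nrm \<F> V"
proof -
  obtain X Y where XY: "X \<in> cseqs" "U = cls X" "Y \<in> cseqs" "V = cls Y"
    using assms by (auto simp: carrier_free_product)
  show ?thesis
    unfolding XY(2,4) cls_add[OF XY(1,3)]
    by (rule LIMSEQ_le[OF nrm_cls tendsto_add[OF nrm_cls nrm_cls]])
      (use XY in \<open>simp_all add: free_norm_add\<close>)
qed

lemma nrm_free_product_uminus:
  assumes "U \<in> carrier \<F>"
  shows "nrm \<F> (\<ominus>\<^bsub>\<F>\<^esub> U) = nrm \<F> U"
proof -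
  obtain X where X: "X \<in> cseqs" "U = cls X"
    using assms by (auto simp: carrier_free_product)
  have "(\<lambda>n. free_norm (- X n)) \<longlonglongrightarrow> nrm \<F> (\<ominus>\<^bsub>\<F>\<^esub> U)"
    using nrm_cls[of "\<lambda>n. - X n"] X by (simp add: cls_uminus)
  then show ?thesis
    using LIMSEQ_unique[OF nrm_cls[OF X(1)]] X by simp
qed

lemma nrm_index_endo_le:
  assumes "U \<in> carrier \<F>"
  shows "nrm \<F> (index_endo A f U) \<le> nrm \<F> U"
proof -
  obtain X where X: "X \<in> cseqs" "U = cls X"
    using assms by (auto simp: carrier_free_product)
  show ?thesis
    unfolding X(2) index_endo_cls[OF X(1)]
    by (rule LIMSEQ_le[OF nrm_cls nrm_cls]) (use X in \<open>simp_all add: free_norm_relabel\<close>)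
qed

lemma index_endo_closed: "U \<in> carrier \<F> \<Longrightarrow> index_endo A f U \<in> carrier \<F>"
  by (auto simp: carrier_free_product index_endo_cls)

lemma index_endo_add:
  "U \<in> carrier \<F> \<Longrightarrow> V \<in> carrier \<F> \<Longrightarrow>
     index_endo A f (U \<oplus>\<^bsub>\<F>\<^esub> V) = index_endo A f U \<oplus>\<^bsub>\<F>\<^esub> index_endo A f V"
  by (auto simp: carrier_free_product index_endo_cls cls_add relabel_add)

lemma index_endo_smult:
  "U \<in> carrier \<F> \<Longrightarrow> index_endo A f (c \<odot>\<^bsub>\<F>\<^esub> U) = c \<odot>\<^bsub>\<F>\<^esub> index_endo A f U"
  by (auto simp: carrier_free_product index_endo_cls cls_smult relabel_smult)

lemma smult_free_product_closed: "U \<in> carrier \<F> \<Longrightarrow> c \<odot>\<^bsub>\<F>\<^esub> U \<in> carrier \<F>"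
  by (auto simp: carrier_free_product cls_smult)

lemma smult_free_product_add:
  "U \<in> carrier \<F> \<Longrightarrow> V \<in> carrier \<F> \<Longrightarrow> c \<odot>\<^bsub>\<F>\<^esub> (U \<oplus>\<^bsub>\<F>\<^esub> V) = c \<odot>\<^bsub>\<F>\<^esub> U \<oplus>\<^bsub>\<F>\<^esub> c \<odot>\<^bsub>\<F>\<^esub> V"
  by (auto simp: carrier_free_product cls_smult cls_add free_smult_add)

text \<open>Scalars act through multiples of the unit, so an ideal of the ring is automatically
  closed under complex multiples.\<close>

lemma smult_free_product_eq_mult:
  "U \<in> carrier \<F> \<Longrightarrow> c \<odot>\<^bsub>\<F>\<^esub> U = (c \<odot>\<^bsub>\<F>\<^esub> \<one>\<^bsub>\<F>\<^esub>) \<otimes>\<^bsub>\<F>\<^esub> U"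
  by (auto simp: carrier_free_product cls_smult cls_one cls_mult free_smult_one_mult)

lemma one_free_product_closed: "\<one>\<^bsub>\<F>\<^esub> \<in> carrier \<F>"
  by (simp add: cls_one)

lemma monomial_eq_cls:
  assumes "snd ` set w \<subseteq> carrier A"
  shows "monomial A w = cls (\<lambda>n. Poly_Mapping.single (Word w) 1)"
  using assms
proof (induction w)
  case Nil
  then show ?case by (simp add: monomial_def cls_one)
next
  case (Cons l w)
  have "monomial A (l # w) = emb A (fst l) (snd l) \<otimes>\<^bsub>\<F>\<^esub> monomial A w"
    by (simp add: monomial_def case_prod_beta)
  also have "\<dots> = cls (\<lambda>n. gen (fst l) (snd l) * Poly_Mapping.single (Word w) 1)"
    using Cons by (simp add: emb_def cls_mult good_word_def)
  also have "gen (fst l) (snd l) * Poly_Mapping.single (Word w) 1 = Poly_Mapping.single (Word (l # w)) 1"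
    by (simp add: gen_def mult_single plus_free_monoid_def)
  finally show ?case .
qed

lemma monomial_closed: "snd ` set w \<subseteq> carrier A \<Longrightarrow> monomial A w \<in> carrier \<F>"
  by (simp add: monomial_eq_cls good_word_def)

lemma index_endo_monomial:
  assumes "snd ` set w \<subseteq> carrier A"
  shows "index_endo A f (monomial A w) = monomial A (map (apfst f) w)"
  using assms by (simp add: monomial_eq_cls index_endo_cls good_word_def image_image)

text \<open>Density of the polynomials in additive form: a tail term of a Cauchy sequence serves as
  the constant, and the small remainder \<open>V\<close> can be split off by any additive
  functional.\<close>

lemma free_product_approx_const:
  assumes "U \<in> carrier \<F>" "e > 0"
  obtains x V where "x \<in> free_alg" "V \<in> carrier \<F>" "U = cls (\<lambda>n. x) \<oplus>\<^bsub>\<F>\<^esub> V" "nrm \<F> V \<le> e"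
proof -
  obtain X where X: "X \<in> cseqs" "U = cls X"
    using assms by (auto simp: carrier_free_product)
  obtain M where M: "\<And>m n. m \<ge> M \<Longrightarrow> n \<ge> M \<Longrightarrow> free_norm (X m - X n) < e"
    using cauchy_seqsD[OF X(1) assms(2)] by blast
  have "nrm \<F> (cls (\<lambda>n. X n - X M)) \<le> e"
    by (rule LIMSEQ_le_const2[OF nrm_cls]) (use X M in \<open>auto intro!: exI[of _ M] less_imp_le\<close>)
  then show ?thesis
    using X by (intro that[of "X M" "cls (\<lambda>n. X n - X M)"]) (simp_all add: cls_add)
qed

end

section \<open>Density in the quotient\<close>

text \<open>Just the structure that yields a metric, so that the same facts serve the free product
  and its quotient.\<close>

locale normed_abelian_group = abelian_group R for R :: "('a, 'm) star_alg_scheme" (structure) +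
  assumes nrm_nonneg: "x \<in> carrier R \<Longrightarrow> 0 \<le> nrm R x"
    and nrm_zero_iff: "x \<in> carrier R \<Longrightarrow> nrm R x = 0 \<longleftrightarrow> x = \<zero>"
    and nrm_triangle: "x \<in> carrier R \<Longrightarrow> y \<in> carrier R \<Longrightarrow> nrm R (x \<oplus> y) \<le> nrm R x + nrm R y"
    and nrm_uminus: "x \<in> carrier R \<Longrightarrow> nrm R (\<ominus> x) = nrm R x"
begin

lemma minus_add_cancel:
  assumes "x \<in> carrier R" "y \<in> carrier R"
  shows "x \<ominus> y \<oplus> y = x"
  using assms by (simp add: a_minus_def a_assoc l_neg)

lemma minus_eq_zero_iff: "x \<in> carrier R \<Longrightarrow> y \<in> carrier R \<Longrightarrow> x \<ominus> y = \<zero> \<longleftrightarrow> x = y"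
  using minus_add_cancel[of x y] by (auto simp: a_minus_def r_neg)

lemma minus_swap: "x \<in> carrier R \<Longrightarrow> y \<in> carrier R \<Longrightarrow> \<ominus> (y \<ominus> x) = x \<ominus> y"
  by (simp add: a_minus_def minus_add a_comm)

lemma Metric_space_nrm_dist: "Metric_space (carrier R) (nrm_dist R)"
proof
  fix x y z
  show "0 \<le> nrm_dist R x y"
    by (simp add: nrm_dist_def nrm_nonneg)
  show "nrm_dist R x y = nrm_dist R y x"
    using nrm_uminus[of "y \<ominus> x"] by (auto simp: nrm_dist_def minus_swap)
  assume x: "x \<in> carrier R" and y: "y \<in> carrier R"
  then show "nrm_dist R x y = 0 \<longleftrightarrow> x = y"
    by (simp add: nrm_dist_def nrm_zero_iff minus_eq_zero_iff)
  assume z: "z \<in> carrier R"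
  have "x \<ominus> z = (x \<ominus> y) \<oplus> (y \<ominus> z)"
    using x y z minus_add_cancel[OF x y] a_assoc[of "x \<ominus> y" y "\<ominus> z"] by (simp add: a_minus_def)
  then show "nrm_dist R x z \<le> nrm_dist R x y + nrm_dist R y z"
    using x y z nrm_triangle[of "x \<ominus> y" "y \<ominus> z"] by (simp add: nrm_dist_def)
qed

end

locale normed_quotient = normed_abelian_group R + ideal I R
  for R :: "('a, 'm) star_alg_scheme" (structure) and I +
  assumes closed: "closedin (nrm_topology R) I"
    and smult_closed: "x \<in> carrier R \<Longrightarrow> c \<odot> x \<in> carrier R"
    and smult_add: "x \<in> carrier R \<Longrightarrow> y \<in> carrier R \<Longrightarrow> c \<odot> (x \<oplus> y) = c \<odot> x \<oplus> c \<odot> y"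
    and smult_ideal: "x \<in> I \<Longrightarrow> c \<odot> x \<in> I"
begin

abbreviation "Q \<equiv> quotient_alg R I"

lemma coset_eq: "x \<in> carrier R \<Longrightarrow> I +> x = {i \<oplus> x |i. i \<in> I}"
  by (auto simp: a_r_coset_def')

lemma coset_eqI:
  assumes "x \<in> carrier R" "i \<in> I"
  shows "I +> (i \<oplus> x) = I +> x"
  using assms by (intro a_repr_independence[symmetric] a_subgroup) (auto simp: coset_eq)

lemma coset_nonempty: "x \<in> carrier R \<Longrightarrow> I +> x \<noteq> {}"
  using a_rcos_self by blast

lemma carrier_quotient: "carrier Q = {I +> x |x. x \<in> carrier R}"
  by (auto simp: quotient_alg_def FactRing_def A_RCOSETS_def')

lemma coset_closed [simp]: "x \<in> carrier R \<Longrightarrow> I +> x \<in> carrier Q"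
  by (auto simp: carrier_quotient)

lemma coset_add: "x \<in> carrier R \<Longrightarrow> y \<in> carrier R \<Longrightarrow> (I +> x) \<oplus>\<^bsub>Q\<^esub> (I +> y) = I +> (x \<oplus> y)"
  by (simp add: quotient_alg_def FactRing_def a_rcos_sum)

lemma zero_quotient: "\<zero>\<^bsub>Q\<^esub> = I"
  by (simp add: quotient_alg_def FactRing_def)

lemma coset_smult:
  assumes "x \<in> carrier R"
  shows "c \<odot>\<^bsub>Q\<^esub> (I +> x) = I +> (c \<odot> x)"
proof -
  have "(\<Union>y\<in>I +> x. I +> (c \<odot> y)) = I +> (c \<odot> x)"
  proof (rule SUP_eq_const[OF coset_nonempty[OF assms]])
    fix y assume "y \<in> I +> x"
    then obtain i where "i \<in> I" "y = i \<oplus> x"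
      using assms by (auto simp: coset_eq)
    then show "I +> (c \<odot> y) = I +> (c \<odot> x)"
      using assms by (simp add: smult_add smult_closed smult_ideal coset_eqI)
  qed
  then show ?thesis
    by (simp add: quotient_alg_def)
qed

lemma coset_zero: "I +> \<zero> = \<zero>\<^bsub>Q\<^esub>"
proof -
  have "I +> \<zero> = (\<lambda>i. i \<oplus> \<zero>) ` I"
    unfolding Setcompr_eq_image[symmetric] by (rule coset_eq) simp
  also have "\<dots> = id ` I"
    by (rule image_cong) simp_all
  finally show ?thesis
    by (simp add: zero_quotient)
qed

lemma abelian_group_quotient: "abelian_group Q"
proof (rule abelian_groupI)
  fix X assume "X \<in> carrier Q"
  then obtain x where "x \<in> carrier R" "X = I +> x"
    by (auto simp: carrier_quotient)
  then show "\<exists>Y\<in>carrier Q. Y \<oplus>\<^bsub>Q\<^esub> X = \<zero>\<^bsub>Q\<^esub>"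
    by (intro bexI[of _ "I +> (\<ominus> x)"]) (simp_all add: coset_add l_neg coset_zero)
qed (unfold coset_zero[symmetric], auto simp: carrier_quotient coset_add a_ac)

lemma coset_uminus:
  assumes "x \<in> carrier R"
  shows "\<ominus>\<^bsub>Q\<^esub> (I +> x) = I +> (\<ominus> x)"
  by (rule abelian_group.minus_equality[OF abelian_group_quotient])
    (use assms in \<open>simp_all add: coset_add coset_zero l_neg\<close>)

lemma coset_minus:
  "x \<in> carrier R \<Longrightarrow> y \<in> carrier R \<Longrightarrow> (I +> x) \<ominus>\<^bsub>Q\<^esub> (I +> y) = I +> (x \<ominus> y)"
  by (simp add: a_minus_def coset_uminus coset_add)

lemma nrm_quotient: "nrm Q X = (INF x\<in>X. nrm R x)"
  by (simp add: quotient_alg_def)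

lemma nrm_coset_le:
  assumes "x \<in> carrier R" "i \<in> I"
  shows "nrm Q (I +> x) \<le> nrm R (i \<oplus> x)"
  unfolding nrm_quotient
  by (rule cINF_lower) (use assms in \<open>auto simp: coset_eq intro!: bdd_belowI[of _ 0] nrm_nonneg\<close>)

text \<open>The infimum need not be attained; estimates in the quotient use representatives that
  come within a positive slack.\<close>

lemma nrm_coset_less:
  assumes "x \<in> carrier R" "nrm Q (I +> x) < e"
  obtains i where "i \<in> I" "nrm R (i \<oplus> x) < e"
proof -
  have "bdd_below (nrm R ` (I +> x))"
    using assms(1) by (auto simp: coset_eq intro!: bdd_belowI[of _ 0] nrm_nonneg)
  with coset_nonempty[OF assms(1)] show ?thesis
    using assms that unfolding nrm_quotient by (subst (asm) cINF_less_iff) (auto simp: coset_eq)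
qed

lemma nrm_coset_ge_0:
  assumes "x \<in> carrier R"
  shows "0 \<le> nrm Q (I +> x)"
  unfolding nrm_quotient
  by (rule cINF_greatest[OF coset_nonempty[OF assms]])
    (use assms in \<open>auto simp: coset_eq intro!: nrm_nonneg\<close>)

text \<open>Definiteness is where closedness of \<open>I\<close> enters: a coset of norm zero has
  representatives of arbitrarily small norm, which puts elements of \<open>I\<close> arbitrarily
  close to \<open>x\<close>.\<close>

lemma normed_abelian_group_quotient: "normed_abelian_group Q"
proof (intro normed_abelian_group.intro normed_abelian_group_axioms.intro)
  show "abelian_group Q"
    by (rule abelian_group_quotient)
next
  fix X assume "X \<in> carrier Q"
  then obtain x where x: "x \<in> carrier R" "X = I +> x"
    by (auto simp: carrier_quotient)
  then show "0 \<le> nrm Q X"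
    by (simp add: nrm_coset_ge_0)
  show "nrm Q X = 0 \<longleftrightarrow> X = \<zero>\<^bsub>Q\<^esub>"
  proof
    assume "X = \<zero>\<^bsub>Q\<^esub>"
    then have "x \<in> I"
      using x a_rcos_self[of x] by (simp add: zero_quotient)
    then have "nrm Q X \<le> nrm R (\<ominus> x \<oplus> x)"
      unfolding x(2) using x(1) by (intro nrm_coset_le) auto
    also have "\<dots> = 0"
      using x(1) by (simp add: l_neg nrm_zero_iff)
    finally show "nrm Q X = 0"
      using x nrm_coset_ge_0 by (intro antisym) auto
  next
    assume 0: "nrm Q X = 0"
    interpret Metric_space "carrier R" "nrm_dist R"
      by (rule Metric_space_nrm_dist)
    have "x \<in> I"
    proof (rule ccontr)
      assume "x \<notin> I"
      then obtain r where r: "r > 0" "disjnt I (mball x r)"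
        using closed x(1) unfolding nrm_topology_def closedin_metric by blast
      obtain i where i: "i \<in> I" "nrm R (i \<oplus> x) < r"
        using nrm_coset_less[of x r] 0 r(1) x by auto
      \<comment> \<open>The distance from \<open>x\<close> to \<open>\<ominus> i\<close> is the norm
        of \<open>i \<oplus> x\<close>.\<close>
      have "\<ominus> i \<in> mball x r"
        using i x(1) by (simp add: nrm_dist_def a_minus_def a_comm)
      then show False
        using r(2) i(1) by (auto simp: disjnt_def)
    qed
    then show "X = \<zero>\<^bsub>Q\<^esub>"
      using x coset_eqI[of \<zero> x] by (simp add: coset_zero)
  qed
  show "nrm Q (\<ominus>\<^bsub>Q\<^esub> X) = nrm Q X"
  proof -
    have le: "nrm Q (I +> (\<ominus> y)) \<le> nrm Q (I +> y)" if y: "y \<in> carrier R" for y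
    proof (rule field_le_epsilon)
      fix e :: real assume "e > 0"
      then obtain i where i: "i \<in> I" "nrm R (i \<oplus> y) < nrm Q (I +> y) + e"
        using nrm_coset_less[OF y, of "nrm Q (I +> y) + e"] by auto
      have "nrm Q (I +> (\<ominus> y)) \<le> nrm R (\<ominus> i \<oplus> \<ominus> y)"
        using i y by (intro nrm_coset_le) auto
      also have "\<dots> = nrm R (i \<oplus> y)"
        using i y nrm_uminus[of "i \<oplus> y"] by (simp add: minus_add)
      finally show "nrm Q (I +> (\<ominus> y)) \<le> nrm Q (I +> y) + e"
        using i by simp
    qed
    show ?thesis
      using le[of x] le[of "\<ominus> x"] x by (simp add: coset_uminus)
  qed
  fix Y assume "Y \<in> carrier Q"
  then obtain y where y: "y \<in> carrier R" "Y = I +> y"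
    by (auto simp: carrier_quotient)
  show "nrm Q (X \<oplus>\<^bsub>Q\<^esub> Y) \<le> nrm Q X + nrm Q Y"
  proof (rule field_le_epsilon)
    fix e :: real assume e: "e > 0"
    obtain i where i: "i \<in> I" "nrm R (i \<oplus> x) < nrm Q X + e / 2"
      using nrm_coset_less[OF x(1), of "nrm Q X + e / 2"] x(2) e by auto
    obtain j where j: "j \<in> I" "nrm R (j \<oplus> y) < nrm Q Y + e / 2"
      using nrm_coset_less[OF y(1), of "nrm Q Y + e / 2"] y(2) e by auto
    have "nrm Q (X \<oplus>\<^bsub>Q\<^esub> Y) \<le> nrm R ((i \<oplus> j) \<oplus> (x \<oplus> y))"
      unfolding x(2) y(2) coset_add[OF x(1) y(1)] using x y i j by (intro nrm_coset_le) auto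
    also have "(i \<oplus> j) \<oplus> (x \<oplus> y) = (i \<oplus> x) \<oplus> (j \<oplus> y)"
      using x y i j by (simp add: a_ac)
    also have "nrm R \<dots> \<le> nrm R (i \<oplus> x) + nrm R (j \<oplus> y)"
      using x y i j by (intro nrm_triangle) auto
    finally show "nrm Q (X \<oplus>\<^bsub>Q\<^esub> Y) \<le> nrm Q X + nrm Q Y + e"
      using i j by simp
  qed
qed

text \<open>Instead of constructing the induced functional on the quotient, the proof approximates
  the coset of \<open>x\<close> by one that contains an element \<open>y\<close> of the kernel of
  \<open>D\<close>. Since \<open>D\<close> vanishes on \<open>I\<close>, its value at
  \<open>x\<close> equals its value at any representative of the difference, which can be chosen
  small.\<close>

lemma bounded_functional_eq_0:
  fixes D :: "'a \<Rightarrow> complex"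
  assumes dense: "nrm_topology Q closure_of lin_span Q ((\<lambda>m. I +> m) ` M) = carrier Q"
    and add: "\<And>x y. x \<in> carrier R \<Longrightarrow> y \<in> carrier R \<Longrightarrow> D (x \<oplus> y) = D x + D y"
    and smult: "\<And>c x. x \<in> carrier R \<Longrightarrow> D (c \<odot> x) = c * D x"
    and bound: "\<And>x. x \<in> carrier R \<Longrightarrow> cmod (D x) \<le> K * nrm R x"
    and ideal: "\<And>x. x \<in> I \<Longrightarrow> D x = 0"
    and M: "M \<subseteq> carrier R" "\<And>m. m \<in> M \<Longrightarrow> D m = 0"
    and x: "x \<in> carrier R"
  shows "D x = 0"
proof -
  interpret Q: normed_abelian_group Q
    by (rule normed_abelian_group_quotient)
  interpret QM: Metric_space "carrier Q" "nrm_dist Q"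
    by (rule Q.Metric_space_nrm_dist)
  have "D (\<zero> \<oplus> \<zero>) = D \<zero> + D \<zero>"
    by (intro add) auto
  then have D0: "D \<zero> = 0"
    by simp
  \<comment> \<open>Each combination of cosets of elements of \<open>M\<close> is the coset of the
    same combination taken in \<open>R\<close>, where \<open>D\<close> vanishes by
    linearity.\<close>
  have sum: "\<exists>y\<in>carrier R. finsum Q (\<lambda>s. c s \<odot>\<^bsub>Q\<^esub> s) T = I +> y \<and> D y = 0"
    if "finite T" "T \<subseteq> (\<lambda>m. I +> m) ` M" for T c
    using that
  proof (induction T)
    case empty
    then show ?case
      using D0 by (intro bexI[of _ \<zero>]) (auto simp: coset_zero)
  next
    case (insert s T)
    obtain m where m: "m \<in> M" "s = I +> m"
      using insert.prems by auto
    obtain y where y: "y \<in> carrier R" "finsum Q (\<lambda>s. c s \<odot>\<^bsub>Q\<^esub> s) T = I +> y" "D y = 0"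
      using insert by auto
    have mR: "m \<in> carrier R"
      using M m by auto
    have "(\<lambda>s. c s \<odot>\<^bsub>Q\<^esub> s) \<in> insert s T \<rightarrow> carrier Q"
    proof
      fix t assume "t \<in> insert s T"
      then obtain k where "k \<in> M" "t = I +> k"
        using insert.prems by auto
      then show "c t \<odot>\<^bsub>Q\<^esub> t \<in> carrier Q"
        using M(1) by (auto simp: coset_smult smult_closed)
    qed
    then have "finsum Q (\<lambda>s. c s \<odot>\<^bsub>Q\<^esub> s) (insert s T) = c s \<odot>\<^bsub>Q\<^esub> s \<oplus>\<^bsub>Q\<^esub> finsum Q (\<lambda>s. c s \<odot>\<^bsub>Q\<^esub> s) T"
      using insert.hyps by (intro Q.finsum_insert) auto
    also have "\<dots> = I +> (c s \<odot> m \<oplus> y)"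
      using y(2) m(2) mR y(1) by (simp add: coset_smult coset_add smult_closed)
    finally show ?case
      using mR y M(2)[OF m(1)] by (intro bexI[of _ "c s \<odot> m \<oplus> y"]) (auto simp: add smult smult_closed)
  qed
  have small: "cmod (D x) \<le> \<bar>K\<bar> * e" if "e > 0" for e
  proof -
    have "I +> x \<in> nrm_topology Q closure_of lin_span Q ((\<lambda>m. I +> m) ` M)"
      using x dense by simp
    then obtain Y where "Y \<in> lin_span Q ((\<lambda>m. I +> m) ` M)" and Y: "Y \<in> QM.mball (I +> x) e"
      using \<open>e > 0\<close> unfolding nrm_topology_def QM.metric_closure_of by blast
    then obtain T c where "finite T" "T \<subseteq> (\<lambda>m. I +> m) ` M" "Y = finsum Q (\<lambda>s. c s \<odot>\<^bsub>Q\<^esub> s) T"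
      unfolding lin_span_def by blast
    with sum[of T c] obtain y where y: "y \<in> carrier R" "Y = I +> y" "D y = 0"
      by auto
    have "nrm Q (I +> (x \<ominus> y)) < e"
      using Y x y by (simp add: nrm_dist_def coset_minus)
    then obtain i where i: "i \<in> I" "nrm R (i \<oplus> (x \<ominus> y)) < e"
      using nrm_coset_less[of "x \<ominus> y"] x y by auto
    have "D x = D (i \<oplus> (x \<ominus> y))"
      using add[of i "x \<ominus> y"] add[of "x \<ominus> y" y] i x y ideal[of i] by (simp add: minus_add_cancel)
    then have "cmod (D x) \<le> K * nrm R (i \<oplus> (x \<ominus> y))"
      using bound[of "i \<oplus> (x \<ominus> y)"] i x y by simp
    also have "\<dots> \<le> \<bar>K\<bar> * e"
      using i x y by (intro mult_mono) (auto intro!: nrm_nonneg)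
    finally show ?thesis .
  qed
  have "cmod (D x) \<le> 0 + e" if "e > 0" for e
  proof -
    \<comment> \<open>The denominator \<open>\<bar>K\<bar> + 1\<close> keeps the radius defined and
      positive when \<open>K\<close> is zero.\<close>
    have "cmod (D x) \<le> \<bar>K\<bar> * (e / (\<bar>K\<bar> + 1))"
      using that by (intro small divide_pos_pos) auto
    also have "\<dots> \<le> e"
      using that by (simp add: field_simps)
    finally show ?thesis by simp
  qed
  then show ?thesis
    using field_le_epsilon[of "cmod (D x)" 0] by simp
qed

end

section \<open>Exchangeability and spreadability\<close>

lemma distinct_adj_if_distinct: "distinct xs \<Longrightarrow> distinct_adj xs"
  by (simp add: distinct_adj_conv_nth nth_eq_iff_index_eq)

lemma sorted_wrt_imp_distinct:
  assumes "\<And>x. \<not> P x x" "sorted_wrt P xs"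
  shows "distinct xs"
  using assms(2) by (induction xs) (use assms(1) in auto)

text \<open>Inside \<open>B \<union> f\<close>
  B\<open>the complements of\<close>B\<open>and of\<close>f \<open>B\<close> have the same size. Any
  bijection between them completes \<open>f\<close> on \<open>B\<close> to a permutation of this
  finite set, extended by the identity.\<close>

lemma finitary_perm_extends:
  fixes f :: "nat \<Rightarrow> nat"
  assumes "inj f" "finite B"
  obtains \<sigma> where "\<sigma> \<in> finitary_perms" "\<And>j. j \<in> B \<Longrightarrow> \<sigma> j = f j"
proof -
  define C where "C = B \<union> f ` B"
  have inj: "inj_on f B"
    using assms(1) by (rule inj_on_subset) simp
  have "card (C - B) = card (C - f ` B)"
    using assms(2) inj by (simp add: C_def card_Diff_subset card_image)
  then obtain h where h: "bij_betw h (C - B) (C - f ` B)"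
    using assms(2) finite_same_card_bij[of "C - B" "C - f ` B"] by (auto simp: C_def)
  define \<sigma> where "\<sigma> j = (if j \<in> B then f j else if j \<in> C then h j else j)" for j
  have "bij_betw \<sigma> B (f ` B)"
    using inj by (subst bij_betw_cong[of B \<sigma> f]) (auto simp: \<sigma>_def bij_betw_def)
  moreover have "bij_betw \<sigma> (C - B) (C - f ` B)"
    using h by (subst bij_betw_cong[of "C - B" \<sigma> h]) (auto simp: \<sigma>_def)
  ultimately have "bij_betw \<sigma> (B \<union> (C - B)) (f ` B \<union> (C - f ` B))"
    by (rule bij_betw_combine) auto
  then have "bij_betw \<sigma> C C"
    by (simp add: C_def Un_Diff_cancel Un_absorb1 Un_commute Un_left_absorb)
  then have "\<sigma> permutes C"
    by (rule bij_imp_permutes) (auto simp: \<sigma>_def C_def)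
  moreover have "finite C"
    using assms(2) by (simp add: C_def)
  ultimately have "\<sigma> \<in> finitary_perms"
    unfolding finitary_perms_def
    by (auto intro: permutes_bij finite_subset[of _ C] simp: permutes_def)
  then show ?thesis
    using that by (simp add: \<sigma>_def)
qed

section \<open>Passing between exchangeability and spreadability\<close>

context unital_cstar_algebra
begin

text \<open>The permutation that imitates \<open>f\<close> depends on the polynomial
  \<open>x\<close>, so it cannot be used for \<open>U\<close> itself. The remainder \<open>V\<close>
  is instead estimated directly: \<open>V\<close> and its image under \<open>f\<close> each
  contribute at most \<open>e / 2\<close>.\<close>

lemma exchangeable_imp_spreadable:
  assumes \<phi>: "state \<F> \<phi>" and "exchangeable A \<phi>"
  shows "spreadable A \<phi>"
  unfolding spreadable_def
proof (intro allI impI ballI)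
  fix f :: "nat \<Rightarrow> nat" and U
  assume f: "strict_mono f" and U: "U \<in> carrier \<F>"
  have \<phi>_add: "\<phi> (V \<oplus>\<^bsub>\<F>\<^esub> W) = \<phi> V + \<phi> W" if "V \<in> carrier \<F>" "W \<in> carrier \<F>" for V W
    using \<phi> that by (simp add: state_def)
  have \<phi>_bound: "cmod (\<phi> V) \<le> nrm \<F> V" if "V \<in> carrier \<F>" for V
    using \<phi> that by (simp add: state_def)
  have "cmod (\<phi> (index_endo A f U) - \<phi> U) \<le> 0 + e" if "e > 0" for e
  proof -
    have "e / 2 > 0"
      using that by simp
    with U obtain x V where x: "x \<in> free_alg" and V: "V \<in> carrier \<F>"
      and U_eq: "U = cls (\<lambda>n. x) \<oplus>\<^bsub>\<F>\<^esub> V" and small: "nrm \<F> V \<le> e / 2"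
      by (rule free_product_approx_const)
    define B where "B = (\<Union>w\<in>Poly_Mapping.keys x. fst ` set (letters w))"
    have "inj f"
      using f by (rule strict_mono_imp_inj_on)
    moreover have "finite B"
      by (simp add: B_def)
    ultimately obtain \<sigma> where \<sigma>: "\<sigma> \<in> finitary_perms" "\<And>j. j \<in> B \<Longrightarrow> \<sigma> j = f j"
      using finitary_perm_extends by metis
    have "relabel f x = relabel \<sigma> x"
    proof (rule relabel_cong)
      fix w j a assume "w \<in> Poly_Mapping.keys x" "(j, a) \<in> set (letters w)"
      then have "j \<in> B"
        unfolding B_def by force
      then show "f j = \<sigma> j"
        by (simp add: \<sigma>(2))
    qed
    then have "\<phi> (index_endo A f (cls (\<lambda>n. x))) = \<phi> (index_endo A \<sigma> (cls (\<lambda>n. x)))"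
      using x by (simp add: index_endo_cls)
    also have "\<dots> = \<phi> (cls (\<lambda>n. x))"
      using \<open>exchangeable A \<phi>\<close> \<sigma>(1) x by (simp add: exchangeable_def)
    finally have "\<phi> (index_endo A f U) - \<phi> U = \<phi> (index_endo A f V) - \<phi> V"
      using x V by (simp add: U_eq index_endo_add \<phi>_add index_endo_closed)
    also have "cmod \<dots> \<le> cmod (\<phi> (index_endo A f V)) + cmod (\<phi> V)"
      by (rule norm_triangle_ineq4)
    also have "\<dots> \<le> nrm \<F> V + nrm \<F> V"
      using V index_endo_closed[OF V] \<phi>_bound nrm_index_endo_le[OF V]
      by (intro add_mono) (auto intro: order.trans)
    finally show ?thesis
      using small by simp
  qed
  then have "cmod (\<phi> (index_endo A f U) - \<phi> U) \<le> 0"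
    by (rule field_le_epsilon)
  then show "\<phi> (index_endo A f U) = \<phi> U"
    by simp
qed

lemma normed_quotient_free_product:
  assumes "ideal I \<F>" "closedin (nrm_topology \<F>) I"
  shows "normed_quotient \<F> I"
proof (intro normed_quotient.intro normed_abelian_group.intro normed_abelian_group_axioms.intro
    normed_quotient_axioms.intro)
  fix U c assume "U \<in> I"
  then show "c \<odot>\<^bsub>\<F>\<^esub> U \<in> I"
    using assms(1) ideal.Icarr[OF assms(1)]
    by (subst smult_free_product_eq_mult)
      (auto intro: ideal.I_l_closed smult_free_product_closed one_free_product_closed)
qed (simp_all add: assms abelian_group_free_product nrm_free_product_ge_0 nrm_free_product_eq_0
    nrm_free_product_add nrm_free_product_uminus smult_free_product_closed smult_free_product_add)

text \<open>The permuted functional and \<open>\<phi>\<close> are compared through their difference,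
  which is linear, bounded and zero on \<open>I\<close>. On ordered monomials both are moments in
  the given representation, so \<open>exch\<close> yields equality there and density does the
  rest.\<close>

lemma spreadable_imp_exchangeable:
  fixes \<iota> :: "nat \<Rightarrow> 'a \<Rightarrow> 'h::chilbert_space \<Rightarrow> 'h" and I :: "'a free_product_elem set"
  assumes "ideal I \<F>" "closedin (nrm_topology \<F>) I"
    and invariant: "\<And>\<sigma>. \<sigma> \<in> finitary_perms \<Longrightarrow> index_endo A \<sigma> ` I \<subseteq> I"
    and dense: "nrm_topology (quotient_alg \<F> I) closure_of
        lin_span (quotient_alg \<F> I) (ordered_monomials A I) = carrier (quotient_alg \<F> I)"
    and rep: "\<And>j. unital_star_rep A (\<iota> j)"
    and dist: "distribution A \<iota> \<xi> \<phi>"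
    and factor: "factorizes_through A I \<phi>"
    and spread: "spreadable A \<phi>"
  shows "exchangeable A \<phi>"
proof -
  interpret Q: normed_quotient \<F> I
    by (rule normed_quotient_free_product) fact+
  interpret star_reps A \<iota> \<xi>
    by unfold_locales (rule rep)
  have \<phi>: "state \<F> \<phi>"
    using dist by (simp add: distribution_def)
  have \<phi>_monomial: "\<phi> (monomial A w) = moment w" if "w \<in> words" "distinct_adj (map fst w)" for w
    using dist that by (simp add: distribution_def words_def moment_def word_op_def)
  interpret spreadable_reps A \<iota> \<xi>
  proof
    fix f :: "nat \<Rightarrow> nat" and w assume f: "strict_mono f" and w: "w \<in> words" "distinct_adj (map fst w)"
    have "distinct_adj (map f (map fst w))"
      using w(2) strict_mono_imp_inj_on[OF f, of UNIV]
      by (subst distinct_adj_map_iff) (auto intro: inj_on_subset)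
    then have "moment (map (apfst f) w) = \<phi> (monomial A (map (apfst f) w))"
      using w by (subst \<phi>_monomial) (simp_all add: comp_def)
    also have "\<dots> = \<phi> (index_endo A f (monomial A w))"
      using w by (simp add: index_endo_monomial words_def)
    also have "\<dots> = moment w"
      using spread f w by (simp add: spreadable_def monomial_closed words_def \<phi>_monomial)
    finally show "moment (map (apfst f) w) = moment w" .
  qed
  \<comment> \<open>An element of \<open>I\<close> has the same coset as zero, and
    \<open>\<phi>\<close> depends only on the coset.\<close>
  have \<phi>_I: "\<phi> U = 0" if U: "U \<in> I" for U
  proof -
    obtain \<psi> where \<psi>: "state (quotient_alg \<F> I) \<psi>" "\<And>V. V \<in> carrier \<F> \<Longrightarrow> \<phi> V = \<psi> (I +>\<^bsub>\<F>\<^esub> V)"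
      using factor by (auto simp: factorizes_through_def)
    have "\<phi> \<zero>\<^bsub>\<F>\<^esub> = 0"
    proof -
      have "\<phi> (\<zero>\<^bsub>\<F>\<^esub> \<oplus>\<^bsub>\<F>\<^esub> \<zero>\<^bsub>\<F>\<^esub>) = \<phi> \<zero>\<^bsub>\<F>\<^esub> + \<phi> \<zero>\<^bsub>\<F>\<^esub>"
        using \<phi> Q.zero_closed unfolding state_def by blast
      then show ?thesis by simp
    qed
    moreover have "I +>\<^bsub>\<F>\<^esub> U = I +>\<^bsub>\<F>\<^esub> \<zero>\<^bsub>\<F>\<^esub>"
      using Q.coset_eqI[of "\<zero>\<^bsub>\<F>\<^esub>" U] U Q.Icarr[OF U] by simp
    ultimately show ?thesis
      using \<psi>(2) Q.Icarr[OF U] by simp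
  qed
  show ?thesis
    unfolding exchangeable_def
  proof (intro ballI)
    fix \<sigma> U assume \<sigma>: "\<sigma> \<in> finitary_perms" and U: "U \<in> carrier \<F>"
    define M where "M = monomial A ` {w \<in> words. sorted_wrt (<) (map fst w) \<or> sorted_wrt (>) (map fst w)}"
    have "ordered_monomials A I = (\<lambda>m. I +>\<^bsub>\<F>\<^esub> m) ` M"
      by (auto simp: ordered_monomials_def M_def words_def)
    with dense have dense': "nrm_topology (quotient_alg \<F> I) closure_of
        lin_span (quotient_alg \<F> I) ((\<lambda>m. I +>\<^bsub>\<F>\<^esub> m) ` M) = carrier (quotient_alg \<F> I)"
      by simp
    have "\<phi> (index_endo A \<sigma> U) - \<phi> U = 0"
    proof (rule Q.bounded_functional_eq_0[OF dense', of "\<lambda>U. \<phi> (index_endo A \<sigma> U) - \<phi> U" 2])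
      fix V assume V: "V \<in> carrier \<F>"
      have "cmod (\<phi> (index_endo A \<sigma> V) - \<phi> V) \<le> cmod (\<phi> (index_endo A \<sigma> V)) + cmod (\<phi> V)"
        by (rule norm_triangle_ineq4)
      also have "\<dots> \<le> nrm \<F> (index_endo A \<sigma> V) + nrm \<F> V"
        using \<phi> V index_endo_closed[OF V] unfolding state_def by (intro add_mono) blast+
      \<comment> \<open>The factor 2 counts two functionals of norm at most one, as
        \<open>\<phi>\<close> is a state and relabelling is contractive.\<close>
      also have "\<dots> \<le> 2 * nrm \<F> V"
        using nrm_index_endo_le[OF V] by simp
      finally show "cmod (\<phi> (index_endo A \<sigma> V) - \<phi> V) \<le> 2 * nrm \<F> V" .
    next
      fix V assume "V \<in> I"
      then show "\<phi> (index_endo A \<sigma> V) - \<phi> V = 0"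
        using invariant[OF \<sigma>] by (simp add: \<phi>_I image_subset_iff)
    next
      show "M \<subseteq> carrier \<F>"
        by (auto simp: M_def words_def intro!: monomial_closed)
    next
      fix m assume "m \<in> M"
      then obtain w where "sorted_wrt (<) (map fst w) \<or> sorted_wrt (>) (map fst w)"
        and "w \<in> words" "m = monomial A w"
        unfolding M_def by blast
      \<comment> \<open>Either strict order makes the indices distinct. A permutation keeps them
        distinct, so the permuted word still has distinct neighbours and the distribution evaluates
        it, even when it is no longer ordered.\<close>
      then have w: "w \<in> words" "distinct (map fst w)" "m = monomial A w"
        by (auto elim!: sorted_wrt_imp_distinct[rotated])
      have \<sigma>_exch: "\<sigma> \<in> exch" and "inj \<sigma>"
        using finitary_perms_exch[OF \<sigma>] \<sigma> by (auto simp: finitary_perms_def bij_def)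
      have "\<phi> (index_endo A \<sigma> m) = \<phi> (monomial A (map (apfst \<sigma>) w))"
        using w(1) by (simp add: w(3) index_endo_monomial words_def)
      also have "\<dots> = moment (map (apfst \<sigma>) w)"
      proof (rule \<phi>_monomial)
        have "distinct (map \<sigma> (map fst w))"
          using w(2) \<open>inj \<sigma>\<close> by (subst distinct_map) (auto intro: inj_on_subset)
        then show "distinct_adj (map fst (map (apfst \<sigma>) w))"
          by (intro distinct_adj_if_distinct) (simp add: comp_def)
      qed (use w in simp)
      also have "\<dots> = \<phi> m"
        using w \<sigma>_exch by (simp add: exch_def \<phi>_monomial distinct_adj_if_distinct)
      finally show "\<phi> (index_endo A \<sigma> m) - \<phi> m = 0"
        by simp
    qed (use \<phi> U in \<open>simp_all add: state_def index_endo_add index_endo_smult index_endo_closed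
        right_diff_distrib\<close>)
    then show "\<phi> (index_endo A \<sigma> U) = \<phi> U"
      by simp
  qed
qed

end

theorem theorem3p2:
  fixes A :: "'a star_alg"
    and I :: "'a free_product_elem set"
    and \<iota> :: "nat \<Rightarrow> 'a \<Rightarrow> 'h::chilbert_space \<Rightarrow> 'h"
    and \<xi> :: 'h
    and \<phi> :: "'a free_product_elem \<Rightarrow> complex"
  assumes "unital_cstar_algebra A"
    and "ideal I (free_product A)"
    and "closedin (nrm_topology (free_product A)) I"
    and "\<And>\<sigma>. \<sigma> \<in> finitary_perms \<Longrightarrow> index_endo A \<sigma> ` I \<subseteq> I"
    and "nrm_topology (quotient_alg (free_product A) I) closure_of
           lin_span (quotient_alg (free_product A) I) (ordered_monomials A I)
         = carrier (quotient_alg (free_product A) I)"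
    and "quantum_stochastic_process A \<iota> \<xi>"
    and "distribution A \<iota> \<xi> \<phi>"
    and "factorizes_through A I \<phi>"
  shows "spreadable A \<phi> \<longleftrightarrow> exchangeable A \<phi>"
proof
  assume "spreadable A \<phi>"
  then show "exchangeable A \<phi>"
    using assms by (intro unital_cstar_algebra.spreadable_imp_exchangeable[of A I \<iota> \<xi> \<phi>])
      (auto simp: quantum_stochastic_process_def)
next
  assume "exchangeable A \<phi>"
  then show "spreadable A \<phi>"
    using assms(1,7) by (intro unital_cstar_algebra.exchangeable_imp_spreadable)
      (auto simp: distribution_def)
qed

end
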